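(* Let $\Gamma$ be an ordered monoid whose neutral element $\epsilon$ is its least element, acting effectively on a set $S$, let $A$ be a $\Gamma$-graded $\mathbb{K}$-algebra, and let $C=A\ltimes_\Gamma\operatorname{Maps}(S,\mathbb{K})$. Let $X$ be a convex subset of $S$. Then $$C(X)\cong\chi_XC\chi_X.$$
   Context: $\mathbb{K}$ is a field; algebras are associative and unital. An ordered monoid is a monoid with a (partial) order such that $\gamma<\gamma'$ implies $\alpha\gamma\beta<\alpha\gamma'\beta$. A $\Gamma$-graded algebra is $A=\bigoplus_{\gamma\in\Gamma}A_\gamma$ with $A_{\gamma}A_{\gamma'}\subset A_{\gamma\gamma'}$ and $1\in A_\epsilon$. $\Gamma$ acts effectively on $S$ if $\gamma_1x\ne\gamma_2x$ for all $x\in S$ and $\gamma_1\ne\gamma_2$ in $\Gamma$. $x\le_\Gamma y$ means $y=\gamma x$ for some $\gamma\in\Gamma$. $X\subset S$ is convex if $x\le_\Gamma z\le_\Gamma y$ with $x,y\in X$ implies $z\in X$. $B=\operatorname{Maps}(S,\mathbb{K})$ has the right $\Gamma$-action $f^\gamma(x)=f(\gamma x)$. $C=A\ltimes_\Gamma B$ is the vector space $A\otimes B$ with product $(a\otimes b)(a'\otimes b')=aa'\otimes b^\gamma b'$ for $a'\in A_\gamma$. For $X\subset S$, $\overline X=S\setminus X$, $\chi_X\in B\subset C$ is the indicator function of $X$, and $C(X)=C/C\chi_{\overline X}C$. The isomorphism is one of algebras, where $\chi_XC\chi_X$ has unit $\chi_X$. *)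

theory Defs
  imports
    "HOL-Algebra.Module"
    "HOL-Algebra.QuotRing"
    "HOL-Algebra.Generated_Groups"
begin

section \<open>Ordered monoids and their actions\<close>

locale ordered_monoid = monoid G for G (structure) +
  fixes r :: "'g rel"
  assumes order: "partial_order_on (carrier G) r"
    and strict_mult:
      "\<lbrakk>c \<in> carrier G; d \<in> carrier G; (c, d) \<in> r; c \<noteq> d; a \<in> carrier G; b \<in> carrier G\<rbrakk>
       \<Longrightarrow> (a \<otimes> c \<otimes> b, a \<otimes> d \<otimes> b) \<in> r \<and> a \<otimes> c \<otimes> b \<noteq> a \<otimes> d \<otimes> b"

locale left_monoid_action = monoid G for G (structure) +
  fixes S :: "'s set" and act :: "'g \<Rightarrow> 's \<Rightarrow> 's"
  assumes act_closed: "\<lbrakk>g \<in> carrier G; x \<in> S\<rbrakk> \<Longrightarrow> act g x \<in> S"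
    and act_one: "x \<in> S \<Longrightarrow> act \<one> x = x"
    and act_mult: "\<lbrakk>g \<in> carrier G; h \<in> carrier G; x \<in> S\<rbrakk> \<Longrightarrow> act (g \<otimes> h) x = act g (act h x)"

locale effective_action = left_monoid_action +
  assumes effective:
    "\<lbrakk>x \<in> S; g \<in> carrier G; h \<in> carrier G; g \<noteq> h\<rbrakk> \<Longrightarrow> act g x \<noteq> act h x"

definition act_le :: "('g, 'm) monoid_scheme \<Rightarrow> ('g \<Rightarrow> 's \<Rightarrow> 's) \<Rightarrow> 's \<Rightarrow> 's \<Rightarrow> bool" where
  "act_le G act x y \<longleftrightarrow> (\<exists>g\<in>carrier G. y = act g x)"

definition act_convex ::
    "('g, 'm) monoid_scheme \<Rightarrow> 's set \<Rightarrow> ('g \<Rightarrow> 's \<Rightarrow> 's) \<Rightarrow> 's set \<Rightarrow> bool" where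
  "act_convex G S act X \<longleftrightarrow>
     X \<subseteq> S \<and>
     (\<forall>x\<in>X. \<forall>y\<in>X. \<forall>z\<in>S. act_le G act x z \<and> act_le G act z y \<longrightarrow> z \<in> X)"


section \<open>Associative unital algebras\<close>

text \<open>The library locale \<^locale>\<open>algebra\<close> is restricted to commutative algebras.\<close>

locale assoc_algebra = module K A + ring A for K (structure) and A (structure) +
  assumes smult_mult_left:
      "\<lbrakk>c \<in> carrier K; x \<in> carrier A; y \<in> carrier A\<rbrakk>
       \<Longrightarrow> (c \<odot>\<^bsub>A\<^esub> x) \<otimes>\<^bsub>A\<^esub> y = c \<odot>\<^bsub>A\<^esub> (x \<otimes>\<^bsub>A\<^esub> y)"
    and smult_mult_right:
      "\<lbrakk>c \<in> carrier K; x \<in> carrier A; y \<in> carrier A\<rbrakk>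
       \<Longrightarrow> x \<otimes>\<^bsub>A\<^esub> (c \<odot>\<^bsub>A\<^esub> y) = c \<odot>\<^bsub>A\<^esub> (x \<otimes>\<^bsub>A\<^esub> y)"

locale graded_algebra = assoc_algebra K A + monoid G
  for K (structure) and G (structure) and A (structure) +
  fixes Agr :: "'g \<Rightarrow> 'a set"
  assumes component_submodule: "g \<in> carrier G \<Longrightarrow> submodule (Agr g) K A"
    and direct_sum:
      "a \<in> carrier A \<Longrightarrow>
       \<exists>!c. c \<in> (\<Pi>\<^sub>E g\<in>carrier G. Agr g) \<and>
            finite {g \<in> carrier G. c g \<noteq> \<zero>\<^bsub>A\<^esub>} \<and>
            a = finsum A c {g \<in> carrier G. c g \<noteq> \<zero>\<^bsub>A\<^esub>}"
    and component_mult: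
      "\<lbrakk>g \<in> carrier G; h \<in> carrier G; a \<in> Agr g; b \<in> Agr h\<rbrakk> \<Longrightarrow> a \<otimes>\<^bsub>A\<^esub> b \<in> Agr (g \<otimes>\<^bsub>G\<^esub> h)"
    and component_one: "\<one>\<^bsub>A\<^esub> \<in> Agr \<one>\<^bsub>G\<^esub>"

definition algebra_iso ::
    "('k, 'l) ring_scheme \<Rightarrow> ('k, 'a, 'm) module_scheme \<Rightarrow> ('k, 'b, 'n) module_scheme \<Rightarrow> ('a \<Rightarrow> 'b) set" where
  "algebra_iso K A B =
     {h \<in> ring_iso A B. \<forall>c\<in>carrier K. \<forall>x\<in>carrier A. h (c \<odot>\<^bsub>A\<^esub> x) = c \<odot>\<^bsub>B\<^esub> h x}"

text \<open>
  The ring \<^term>\<open>M Quot N\<close> enriched with scalar multiplication. As a quotient of vector spaces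
  it is also used below when \<^term>\<open>N\<close> is only a submodule; its product is then meaningless and
  has to be overwritten.
\<close>

definition quot_algebra :: "('k, 'a, 'm) module_scheme \<Rightarrow> 'a set \<Rightarrow> ('k, 'a set) module" where
  "quot_algebra M N =
     ring.extend (M Quot N) (module.fields (\<lambda>c V. \<Union>v\<in>V. N +>\<^bsub>M\<^esub> (c \<odot>\<^bsub>M\<^esub> v)))"

text \<open>The two-sided ideal \<open>CeC\<close>: all finite sums of elements \<open>c e c'\<close>.\<close>

definition ideal_of_elem :: "('c, 'm) ring_scheme \<Rightarrow> 'c \<Rightarrow> 'c set" where
  "ideal_of_elem C e =
     generate (add_monoid C) {c \<otimes>\<^bsub>C\<^esub> e \<otimes>\<^bsub>C\<^esub> c' | c c'. c \<in> carrier C \<and> c' \<in> carrier C}"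

definition corner :: "('c, 'm) ring_scheme \<Rightarrow> 'c \<Rightarrow> ('c, 'm) ring_scheme" where
  "corner C e = C\<lparr>carrier := {e \<otimes>\<^bsub>C\<^esub> c \<otimes>\<^bsub>C\<^esub> e | c. c \<in> carrier C}, one := e\<rparr>"


section \<open>Function algebras\<close>

text \<open>Maps on \<^term>\<open>S\<close> are represented by functions that are \<^const>\<open>undefined\<close> outside \<^term>\<open>S\<close>.\<close>

definition Maps :: "'s set \<Rightarrow> ('k, 'l) ring_scheme \<Rightarrow> ('k, 's \<Rightarrow> 'k) module" where
  "Maps S K =
     \<lparr>carrier = S \<rightarrow>\<^sub>E carrier K,
      mult = (\<lambda>f g. \<lambda>x\<in>S. f x \<otimes>\<^bsub>K\<^esub> g x),
      one = (\<lambda>x\<in>S. \<one>\<^bsub>K\<^esub>),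
      zero = (\<lambda>x\<in>S. \<zero>\<^bsub>K\<^esub>),
      add = (\<lambda>f g. \<lambda>x\<in>S. f x \<oplus>\<^bsub>K\<^esub> g x),
      smult = (\<lambda>c f. \<lambda>x\<in>S. c \<otimes>\<^bsub>K\<^esub> f x)\<rparr>"

definition indicator_map :: "'s set \<Rightarrow> ('k, 'l) ring_scheme \<Rightarrow> 's set \<Rightarrow> 's \<Rightarrow> 'k" where
  "indicator_map S K X = (\<lambda>x\<in>S. if x \<in> X then \<one>\<^bsub>K\<^esub> else \<zero>\<^bsub>K\<^esub>)"

definition translate :: "'s set \<Rightarrow> ('g \<Rightarrow> 's \<Rightarrow> 's) \<Rightarrow> ('s \<Rightarrow> 'k) \<Rightarrow> 'g \<Rightarrow> 's \<Rightarrow> 'k" where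
  "translate S act f g = (\<lambda>x\<in>S. f (act g x))"


section \<open>Tensor products\<close>

text \<open>The free vector space on a set; only its vector space structure is used.\<close>

definition free_module :: "'i set \<Rightarrow> ('k, 'l) ring_scheme \<Rightarrow> ('k, 'i \<Rightarrow> 'k) module" where
  "free_module I K =
     (Maps I K)\<lparr>carrier := {f \<in> I \<rightarrow>\<^sub>E carrier K. finite {i \<in> I. f i \<noteq> \<zero>\<^bsub>K\<^esub>}}\<rparr>"

definition module_span ::
    "('k, 'l) ring_scheme \<Rightarrow> ('k, 'a, 'm) module_scheme \<Rightarrow> 'a set \<Rightarrow> 'a set" where
  "module_span K M V = \<Inter> {N. submodule N K M \<and> V \<subseteq> N}"

definition pair_module ::
    "('k, 'l) ring_scheme \<Rightarrow> ('k, 'a, 'm) module_scheme \<Rightarrow> ('k, 'b, 'n) module_scheme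
     \<Rightarrow> ('k, 'a \<times> 'b \<Rightarrow> 'k) module" where
  "pair_module K A B = free_module (carrier A \<times> carrier B) K"

definition pair_elem ::
    "('k, 'l) ring_scheme \<Rightarrow> ('k, 'a, 'm) module_scheme \<Rightarrow> ('k, 'b, 'n) module_scheme
     \<Rightarrow> 'a \<Rightarrow> 'b \<Rightarrow> 'a \<times> 'b \<Rightarrow> 'k" where
  "pair_elem K A B a b = indicator_map (carrier A \<times> carrier B) K {(a, b)}"

definition tensor_relations ::
    "('k, 'l) ring_scheme \<Rightarrow> ('k, 'a, 'm) module_scheme \<Rightarrow> ('k, 'b, 'n) module_scheme
     \<Rightarrow> ('a \<times> 'b \<Rightarrow> 'k) set" where
  "tensor_relations K A B =
     (let F = pair_module K A B; p = pair_elem K A B in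
      module_span K F
       ({p (a \<oplus>\<^bsub>A\<^esub> a') b \<ominus>\<^bsub>F\<^esub> (p a b \<oplus>\<^bsub>F\<^esub> p a' b) | a a' b.
           a \<in> carrier A \<and> a' \<in> carrier A \<and> b \<in> carrier B} \<union>
        {p a (b \<oplus>\<^bsub>B\<^esub> b') \<ominus>\<^bsub>F\<^esub> (p a b \<oplus>\<^bsub>F\<^esub> p a b') | a b b'.
           a \<in> carrier A \<and> b \<in> carrier B \<and> b' \<in> carrier B} \<union>
        {p (c \<odot>\<^bsub>A\<^esub> a) b \<ominus>\<^bsub>F\<^esub> c \<odot>\<^bsub>F\<^esub> p a b | c a b.
           c \<in> carrier K \<and> a \<in> carrier A \<and> b \<in> carrier B} \<union>
        {p a (c \<odot>\<^bsub>B\<^esub> b) \<ominus>\<^bsub>F\<^esub> c \<odot>\<^bsub>F\<^esub> p a b | c a b.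
           c \<in> carrier K \<and> a \<in> carrier A \<and> b \<in> carrier B}))"

definition tensor_module ::
    "('k, 'l) ring_scheme \<Rightarrow> ('k, 'a, 'm) module_scheme \<Rightarrow> ('k, 'b, 'n) module_scheme
     \<Rightarrow> ('k, ('a \<times> 'b \<Rightarrow> 'k) set) module" where
  "tensor_module K A B = quot_algebra (pair_module K A B) (tensor_relations K A B)"

definition tensor ::
    "('k, 'l) ring_scheme \<Rightarrow> ('k, 'a, 'm) module_scheme \<Rightarrow> ('k, 'b, 'n) module_scheme
     \<Rightarrow> 'a \<Rightarrow> 'b \<Rightarrow> ('a \<times> 'b \<Rightarrow> 'k) set" where
  "tensor K A B a b = tensor_relations K A B +>\<^bsub>pair_module K A B\<^esub> pair_elem K A B a b"


section \<open>The crossed product\<close>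

definition bilinear_op ::
    "('k, 'l) ring_scheme \<Rightarrow> ('k, 'a, 'm) module_scheme \<Rightarrow> ('a \<Rightarrow> 'a \<Rightarrow> 'a) \<Rightarrow> bool" where
  "bilinear_op K M m \<longleftrightarrow>
     (\<forall>x\<in>carrier M. \<forall>y\<in>carrier M. m x y \<in> carrier M) \<and>
     (\<forall>x\<in>carrier M. \<forall>y\<in>carrier M. \<forall>z\<in>carrier M.
        m (x \<oplus>\<^bsub>M\<^esub> y) z = m x z \<oplus>\<^bsub>M\<^esub> m y z \<and>
        m z (x \<oplus>\<^bsub>M\<^esub> y) = m z x \<oplus>\<^bsub>M\<^esub> m z y) \<and>
     (\<forall>c\<in>carrier K. \<forall>x\<in>carrier M. \<forall>y\<in>carrier M.
        m (c \<odot>\<^bsub>M\<^esub> x) y = c \<odot>\<^bsub>M\<^esub> m x y \<and>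
        m x (c \<odot>\<^bsub>M\<^esub> y) = c \<odot>\<^bsub>M\<^esub> m x y)"

definition is_crossed_mult ::
    "('k, 'l) ring_scheme \<Rightarrow> ('g, 'n) monoid_scheme \<Rightarrow> ('k, 'a, 'm) module_scheme
     \<Rightarrow> ('g \<Rightarrow> 'a set) \<Rightarrow> 's set \<Rightarrow> ('g \<Rightarrow> 's \<Rightarrow> 's)
     \<Rightarrow> (('a \<times> ('s \<Rightarrow> 'k) \<Rightarrow> 'k) set \<Rightarrow> ('a \<times> ('s \<Rightarrow> 'k) \<Rightarrow> 'k) set
          \<Rightarrow> ('a \<times> ('s \<Rightarrow> 'k) \<Rightarrow> 'k) set) \<Rightarrow> bool" where
  "is_crossed_mult K G A Agr S act m \<longleftrightarrow>
     (let B = Maps S K; t = tensor K A B in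
      bilinear_op K (tensor_module K A B) m \<and>
      (\<forall>g\<in>carrier G. \<forall>a\<in>carrier A. \<forall>a'\<in>Agr g. \<forall>b\<in>carrier B. \<forall>b'\<in>carrier B.
         m (t a b) (t a' b') = t (a \<otimes>\<^bsub>A\<^esub> a') (translate S act b g \<otimes>\<^bsub>B\<^esub> b')))"

text \<open>
  Since the elements \<open>a \<otimes> b\<close> with \<open>a\<close> homogeneous span the tensor product, the operation
  selected by \<open>SOME\<close> is uniquely determined on the carrier. It exists because
  \<open>(a, b, a', b') \<mapsto> \<Sum>\<gamma>. a a'\<^sub>\<gamma> \<otimes> b\<^sup>\<gamma> b'\<close> is multilinear, where \<open>a'\<^sub>\<gamma>\<close> is the component of
  \<open>a'\<close> of degree \<open>\<gamma>\<close>.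
\<close>

definition crossed_product ::
    "('k, 'l) ring_scheme \<Rightarrow> ('g, 'n) monoid_scheme \<Rightarrow> ('k, 'a, 'm) module_scheme
     \<Rightarrow> ('g \<Rightarrow> 'a set) \<Rightarrow> 's set \<Rightarrow> ('g \<Rightarrow> 's \<Rightarrow> 's)
     \<Rightarrow> ('k, ('a \<times> ('s \<Rightarrow> 'k) \<Rightarrow> 'k) set) module" where
  "crossed_product K G A Agr S act =
     (tensor_module K A (Maps S K))
       \<lparr>mult := (SOME m. is_crossed_mult K G A Agr S act m),
        one := tensor K A (Maps S K) \<one>\<^bsub>A\<^esub> \<one>\<^bsub>Maps S K\<^esub>\<rparr>"

text \<open>The image of the indicator function of \<^term>\<open>X\<close> under \<open>B \<rightarrow> C, b \<mapsto> 1 \<otimes> b\<close>.\<close>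

definition chi ::
    "('k, 'l) ring_scheme \<Rightarrow> ('k, 'a, 'm) module_scheme \<Rightarrow> 's set \<Rightarrow> 's set
     \<Rightarrow> ('a \<times> ('s \<Rightarrow> 'k) \<Rightarrow> 'k) set" where
  "chi K A S X = tensor K A (Maps S K) \<one>\<^bsub>A\<^esub> (indicator_map S K X)"

end

theory Submission
  imports Defs
begin

text \<open>
  Write \<open>e = \<chi>\<^sub>X\<close> and \<open>f = \<chi>\<^sub>Y\<close> with \<open>Y = S - X\<close>. These are complementary idempotents of \<open>C\<close>, and
  convexity of \<open>X\<close> gives \<open>e C f C e = 0\<close>: for homogeneous \<open>a\<close> and \<open>a'\<close> of degrees \<open>\<gamma>\<close> and \<open>\<gamma>'\<close>,
  the element \<open>e (a \<otimes> b) f (a' \<otimes> b') e\<close> is \<open>a a' \<otimes> \<phi>\<close>, where \<open>\<phi>(x)\<close> can be nonzero only if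
  \<open>x \<in> X\<close>, \<open>\<gamma>'x \<notin> X\<close> and \<open>\<gamma>\<gamma>'x \<in> X\<close>. As \<open>\<gamma>'x\<close> lies between \<open>x\<close> and \<open>\<gamma>\<gamma>'x\<close>, no such \<open>x\<close>
  exists (\<open>chi_vanish\<close>).

  In any algebra with complementary idempotents \<open>e\<close> and \<open>f\<close> such that \<open>e C f C e = 0\<close>, the
  compression \<open>c \<mapsto> e c e\<close> is multiplicative, because \<open>e c c' e = e c e c' e + e c f c' e\<close>. It maps
  onto the corner \<open>e C e\<close>, and its kernel is the ideal \<open>C f C\<close>: an element with \<open>e c e = 0\<close> equals
  \<open>c f + f c e\<close>. The isomorphism is therefore the one induced by compression
  (\<open>quot_iso_corner\<close>).

  What remains is that \<open>C\<close> really is an associative unital algebra. Its product is a choice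
  among the bilinear operations on \<open>A \<otimes> B\<close> with prescribed values on tensors, so it has to be
  shown that such an operation exists. Evaluation at \<open>x \<in> S\<close> extends \<open>a \<otimes> b \<mapsto> b(x) a\<close> to a linear
  map \<open>ev\<^sub>x\<close> from \<open>A \<otimes> B\<close> to \<open>A\<close>, and over a field these maps together separate the elements
  of \<open>A \<otimes> B\<close> (\<open>eval_injective\<close>). Hence the product \<open>w\<close> of \<open>u\<close> and \<open>v\<close> can be defined by its
  values, \<open>ev\<^sub>x(w) = \<Sum>\<^sub>\<gamma> ev\<^bsub>\<gamma>x\<^esub>(u) ev\<^sub>x(v)\<^sub>\<gamma>\<close>, once these are known to be the values of some
  element; that need only be checked on generators (\<open>crossed_product_exists\<close>). Bilinearity of the
  product can then be read off from the values. Associativity and the unit laws are verified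
  on tensors with homogeneous first factor, which span \<open>A \<otimes> B\<close>
  (\<open>homogeneous_tensor_induct\<close>).
\<close>

section \<open>Quotient modules and spans\<close>

lemma quot_algebra_simps:
  "carrier (quot_algebra M N) = a_rcosets\<^bsub>M\<^esub> N"
  "mult (quot_algebra M N) = rcoset_mult M N"
  "one (quot_algebra M N) = N +>\<^bsub>M\<^esub> \<one>\<^bsub>M\<^esub>"
  "zero (quot_algebra M N) = N"
  "add (quot_algebra M N) = set_add M"
  "smult (quot_algebra M N) c V = (\<Union>v\<in>V. N +>\<^bsub>M\<^esub> (c \<odot>\<^bsub>M\<^esub> v))"
  by (simp_all add: quot_algebra_def ring.defs module.defs FactRing_def)

lemma (in module) submodule_abelian_subgroup: "submodule N R M \<Longrightarrow> abelian_subgroup N M"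
  by (simp add: abelian_subgroupI3 additive_subgroupI submodule_def abelian_group_axioms)

text \<open>
  The scalar multiple of a coset is a union over its elements; all the cosets united coincide
  because \<open>N\<close> is closed under scalars.
\<close>

lemma (in module) quot_smult_coset:
  assumes N: "submodule N R M" and c: "c \<in> carrier R" and x: "x \<in> carrier M"
  shows "c \<odot>\<^bsub>quot_algebra M N\<^esub> (N +>\<^bsub>M\<^esub> x) = N +>\<^bsub>M\<^esub> (c \<odot>\<^bsub>M\<^esub> x)"
proof -
  interpret N: abelian_subgroup N M using N by (rule submodule_abelian_subgroup)
  have "N +>\<^bsub>M\<^esub> (c \<odot>\<^bsub>M\<^esub> v) = N +>\<^bsub>M\<^esub> (c \<odot>\<^bsub>M\<^esub> x)" if "v \<in> N +>\<^bsub>M\<^esub> x" for v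
  proof -
    from that obtain n where n: "n \<in> N" "v = n \<oplus>\<^bsub>M\<^esub> x" by (auto simp: a_r_coset_def')
    then have "c \<odot>\<^bsub>M\<^esub> v = c \<odot>\<^bsub>M\<^esub> n \<oplus>\<^bsub>M\<^esub> c \<odot>\<^bsub>M\<^esub> x"
      using c x by (simp add: smult_r_distr)
    moreover have "c \<odot>\<^bsub>M\<^esub> n \<in> N" using N c n by (simp add: submodule.smult_closed)
    ultimately have "c \<odot>\<^bsub>M\<^esub> v \<in> N +>\<^bsub>M\<^esub> (c \<odot>\<^bsub>M\<^esub> x)" unfolding a_r_coset_def' by blast
    then show ?thesis
      using a_repr_independence[OF _ smult_closed[OF c x] N.a_subgroup] by simp
  qed
  moreover have "x \<in> N +>\<^bsub>M\<^esub> x" using x by (rule N.a_rcos_self)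
  ultimately show ?thesis unfolding quot_algebra_simps by blast
qed

lemma (in module) quot_add_coset:
  assumes N: "submodule N R M" and "x \<in> carrier M" "y \<in> carrier M"
  shows "(N +>\<^bsub>M\<^esub> x) \<oplus>\<^bsub>quot_algebra M N\<^esub> (N +>\<^bsub>M\<^esub> y) = N +>\<^bsub>M\<^esub> (x \<oplus>\<^bsub>M\<^esub> y)"
proof -
  interpret N: abelian_subgroup N M using N by (rule submodule_abelian_subgroup)
  show ?thesis using assms by (simp add: quot_algebra_simps N.a_rcos_sum)
qed

lemma (in module) coset_eqI:
  assumes N: "submodule N R M" and x: "x \<in> carrier M" and y: "y \<in> carrier M"
    and "x \<ominus>\<^bsub>M\<^esub> y \<in> N"
  shows "N +>\<^bsub>M\<^esub> x = N +>\<^bsub>M\<^esub> y"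
proof -
  interpret N: abelian_subgroup N M using N by (rule submodule_abelian_subgroup)
  show ?thesis
    using N.a_rcos_const[OF assms(4)] x y N.a_subset
    by (intro a_coset_add_inv1) (simp_all add: a_minus_def)
qed

lemma (in module) quot_module:
  assumes N: "submodule N R M"
  shows "module R (quot_algebra M N)"
proof -
  interpret N: abelian_subgroup N M using N by (rule submodule_abelian_subgroup)
  have car: "carrier (quot_algebra M N) = (\<lambda>v. N +>\<^bsub>M\<^esub> v) ` carrier M"
    by (auto simp: quot_algebra_simps A_RCOSETS_def')
  note add = quot_add_coset[OF N]
  have zero: "\<zero>\<^bsub>quot_algebra M N\<^esub> = N +>\<^bsub>M\<^esub> \<zero>\<^bsub>M\<^esub>"
    by (simp add: quot_algebra_simps N.a_subset)
  have "abelian_group (quot_algebra M N)"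
  proof (rule abelian_groupI)
    fix V assume "V \<in> carrier (quot_algebra M N)"
    then obtain v where v: "v \<in> carrier M" "V = N +>\<^bsub>M\<^esub> v" by (auto simp: car)
    then have "(N +>\<^bsub>M\<^esub> \<ominus>\<^bsub>M\<^esub> v) \<oplus>\<^bsub>quot_algebra M N\<^esub> V = \<zero>\<^bsub>quot_algebra M N\<^esub>"
      by (simp add: add zero M.l_neg)
    with v show "\<exists>W\<in>carrier (quot_algebra M N). W \<oplus>\<^bsub>quot_algebra M N\<^esub> V = \<zero>\<^bsub>quot_algebra M N\<^esub>"
      by (auto simp: car)
  qed (auto simp: car add zero M.a_ac)
  then show ?thesis
    by (rule moduleI[OF R.is_cring])
      (auto simp: car add quot_smult_coset[OF N] smult_l_distr smult_r_distr smult_assoc1)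
qed

lemma (in module) submodule_span:
  assumes "V \<subseteq> carrier M"
  shows "submodule (module_span R M V) R M"
proof (rule submoduleI)
  have "carrier M \<in> {N. submodule N R M \<and> V \<subseteq> N}"
    using assms carrier_is_submodule by simp
  then show "module_span R M V \<subseteq> carrier M"
    unfolding module_span_def by blast
qed (auto simp: module_span_def dest: submoduleE submodule.axioms(1)
      intro: subgroup.one_closed[where G = "add_monoid M", simplified])

lemma span_superset: "V \<subseteq> module_span R M V"
  by (auto simp: module_span_def)

lemma span_least: "\<lbrakk>submodule N R M; V \<subseteq> N\<rbrakk> \<Longrightarrow> module_span R M V \<subseteq> N"
  by (auto simp: module_span_def)

section \<open>Corner algebras as quotients\<close>

text \<open>
  Inserting \<open>1 = e + f\<close> between two factors splits \<open>e u v e\<close> into \<open>(e u e)(e v e)\<close> and a term that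
  vanishes by hypothesis.
\<close>

lemma (in ring) compression_hom:
  assumes e: "e \<in> carrier R" and f: "f \<in> carrier R"
    and idem: "e \<otimes> e = e" and sum: "e \<oplus> f = \<one>"
    and vanish: "\<And>u v. \<lbrakk>u \<in> carrier R; v \<in> carrier R\<rbrakk> \<Longrightarrow> e \<otimes> u \<otimes> f \<otimes> v \<otimes> e = \<zero>"
  shows "(\<lambda>c. e \<otimes> c \<otimes> e) \<in> ring_hom R (corner R e)"
proof (rule ring_hom_memI)
  fix u v assume u: "u \<in> carrier R" and v: "v \<in> carrier R"
  have "e \<otimes> (u \<otimes> v) \<otimes> e = e \<otimes> (u \<otimes> (e \<oplus> f) \<otimes> v) \<otimes> e"
    using u by (simp add: sum)
  also have "\<dots> = e \<otimes> u \<otimes> e \<otimes> v \<otimes> e \<oplus> e \<otimes> u \<otimes> f \<otimes> v \<otimes> e"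
    using e f u v by (simp add: l_distr r_distr m_assoc)
  also have "\<dots> = e \<otimes> u \<otimes> (e \<otimes> e) \<otimes> v \<otimes> e"
    using e u v by (simp add: vanish idem)
  also have "\<dots> = (e \<otimes> u \<otimes> e) \<otimes> (e \<otimes> v \<otimes> e)"
    using e u v by (simp add: m_assoc)
  finally show "e \<otimes> (u \<otimes> v) \<otimes> e = (e \<otimes> u \<otimes> e) \<otimes>\<^bsub>corner R e\<^esub> (e \<otimes> v \<otimes> e)"
    by (simp add: corner_def)
next
  fix u v assume u: "u \<in> carrier R" and v: "v \<in> carrier R"
  show "e \<otimes> (u \<oplus> v) \<otimes> e = (e \<otimes> u \<otimes> e) \<oplus>\<^bsub>corner R e\<^esub> (e \<otimes> v \<otimes> e)"
    using e u v by (simp add: corner_def l_distr r_distr)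
qed (use e idem in \<open>auto simp: corner_def\<close>)

text \<open>
  The hypothesis \<open>vanish\<close> puts the generators of \<open>RfR\<close> into the kernel; the converse inclusion
  comes from the Peirce decomposition with respect to \<open>e\<close> and \<open>f\<close>.
\<close>

lemma (in ring) kernel_compression:
  assumes e: "e \<in> carrier R" and f: "f \<in> carrier R" and sum: "e \<oplus> f = \<one>"
    and hom: "ring_hom_ring R (corner R e) (\<lambda>c. e \<otimes> c \<otimes> e)"
    and vanish: "\<And>u v. \<lbrakk>u \<in> carrier R; v \<in> carrier R\<rbrakk> \<Longrightarrow> e \<otimes> u \<otimes> f \<otimes> v \<otimes> e = \<zero>"
  shows "a_kernel R (corner R e) (\<lambda>c. e \<otimes> c \<otimes> e) = ideal_of_elem R f" (is "?N = _")
proof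
  let ?gens = "{c \<otimes> f \<otimes> c' | c c'. c \<in> carrier R \<and> c' \<in> carrier R}"
  have N: "?N = {c \<in> carrier R. e \<otimes> c \<otimes> e = \<zero>}"
    by (simp add: a_kernel_def' corner_def)
  interpret H: ring_hom_ring R "corner R e" "\<lambda>c. e \<otimes> c \<otimes> e" by (rule hom)
  have "subgroup ?N (add_monoid R)"
    using H.kernel_is_ideal by (simp add: ideal_def additive_subgroup_def)
  moreover have "?gens \<subseteq> ?N"
    using e f vanish by (auto simp: N m_assoc[symmetric])
  ultimately show "ideal_of_elem R f \<subseteq> ?N"
    unfolding ideal_of_elem_def by (simp add: add.generate_subgroup_incl)
  show "?N \<subseteq> ideal_of_elem R f"
  proof
    fix c assume "c \<in> ?N"
    then have c: "c \<in> carrier R" and ece: "e \<otimes> c \<otimes> e = \<zero>" by (auto simp: N)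
    \<comment> \<open>With \<open>e c e = 0\<close> the Peirce decomposition leaves \<open>c = c f + f c e\<close>.\<close>
    have "c = c \<otimes> (e \<oplus> f)" using c by (simp add: sum)
    also have "\<dots> = c \<otimes> e \<oplus> c \<otimes> f" using c e f by (rule_tac r_distr) 
    also have "\<dots> = (e \<oplus> f) \<otimes> (c \<otimes> e) \<oplus> c \<otimes> f"
      using c e f by (simp add: sum)
    also have "\<dots> = \<one> \<otimes> f \<otimes> (c \<otimes> e) \<oplus> c \<otimes> f \<otimes> \<one>"
      using c e f by (simp add: l_distr ece m_assoc[symmetric])
    finally have "c = \<one> \<otimes> f \<otimes> (c \<otimes> e) \<oplus> c \<otimes> f \<otimes> \<one>" .
    moreover have "\<one> \<otimes> f \<otimes> (c \<otimes> e) \<in> ?gens" "c \<otimes> f \<otimes> \<one> \<in> ?gens"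
      using c e by blast+
    ultimately show "c \<in> ideal_of_elem R f"
      unfolding ideal_of_elem_def
      by (metis (no_types, lifting) generate.eng generate.incl monoid.simps(1))
  qed
qed

lemma algebra_isoI:
  assumes "h \<in> ring_iso A B"
    and "\<And>c x. \<lbrakk>c \<in> carrier K; x \<in> carrier A\<rbrakk> \<Longrightarrow> h (c \<odot>\<^bsub>A\<^esub> x) = c \<odot>\<^bsub>B\<^esub> h x"
  shows "h \<in> algebra_iso K A B"
  using assms by (simp add: algebra_iso_def)

lemma (in assoc_algebra) quot_iso_corner:
  assumes e: "e \<in> carrier A" and f: "f \<in> carrier A"
    and idem: "e \<otimes>\<^bsub>A\<^esub> e = e" and sum: "e \<oplus>\<^bsub>A\<^esub> f = \<one>\<^bsub>A\<^esub>"
    and vanish: "\<And>u v. \<lbrakk>u \<in> carrier A; v \<in> carrier A\<rbrakk>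
                  \<Longrightarrow> e \<otimes>\<^bsub>A\<^esub> u \<otimes>\<^bsub>A\<^esub> f \<otimes>\<^bsub>A\<^esub> v \<otimes>\<^bsub>A\<^esub> e = \<zero>\<^bsub>A\<^esub>"
  shows "(\<lambda>V. the_elem ((\<lambda>c. e \<otimes>\<^bsub>A\<^esub> c \<otimes>\<^bsub>A\<^esub> e) ` V))
           \<in> algebra_iso K (quot_algebra A (ideal_of_elem A f)) (corner A e)"
proof -
  let ?h = "\<lambda>c. e \<otimes>\<^bsub>A\<^esub> c \<otimes>\<^bsub>A\<^esub> e" and ?I = "ideal_of_elem A f"
  have hom: "?h \<in> ring_hom A (corner A e)"
    using assms by (rule compression_hom)
  \<comment> \<open>The library states that homomorphic images are rings for a record with updated carrier
    and zero; for the corner both updates are trivial.\<close>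
  have img: "carrier (corner A e) = ?h ` carrier A" "\<zero>\<^bsub>corner A e\<^esub> = ?h \<zero>\<^bsub>A\<^esub>"
    using e by (auto simp: corner_def)
  have ring: "ring (corner A e)"
    using ring_hom_imp_img_ring[OF hom] by (simp flip: img)
  interpret H: ring_hom_ring A "corner A e" ?h
    by (rule ring_hom_ringI2) (use ring hom ring_axioms in auto)
  have ker: "a_kernel A (corner A e) ?h = ?I"
    using e f sum H.ring_hom_ring_axioms vanish by (rule kernel_compression)
  have iso: "(\<lambda>V. the_elem (?h ` V)) \<in> ring_iso (A Quot ?I) (corner A e)"
    using H.FactRing_iso_set[OF img(1)[symmetric]] by (simp add: ker)
  have elem: "the_elem (?h ` (?I +>\<^bsub>A\<^esub> x)) = ?h x" if x: "x \<in> carrier A" for x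
    using H.the_elem_simp[OF x] by (simp add: ker)
  have sub: "submodule ?I K A"
  proof (rule submodule.intro)
    show "subgroup ?I (add_monoid A)"
      using additive_subgroup.a_subgroup[OF ideal.axioms(1)[OF H.kernel_is_ideal]]
      by (simp only: ker)
    show "submodule_axioms ?I K A"
    proof
      fix c x assume c: "c \<in> carrier K" and "x \<in> ?I"
      then have "x \<in> carrier A" "?h x = \<zero>\<^bsub>A\<^esub>"
        unfolding ker[symmetric] a_kernel_def' by (auto simp: corner_def)
      then have "c \<odot>\<^bsub>A\<^esub> x \<in> carrier A" "?h (c \<odot>\<^bsub>A\<^esub> x) = \<zero>\<^bsub>A\<^esub>"
        using c e by (simp_all add: smult_mult_left smult_mult_right)
      then show "c \<odot>\<^bsub>A\<^esub> x \<in> ?I"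
        unfolding ker[symmetric] a_kernel_def' by (simp add: corner_def)
    qed
  qed
  show ?thesis
  proof (rule algebra_isoI)
    show "(\<lambda>V. the_elem (?h ` V)) \<in> ring_iso (quot_algebra A ?I) (corner A e)"
      using iso by (simp add: ring_iso_def ring_hom_def quot_algebra_def ring.defs)
  next
    fix c V assume c: "c \<in> carrier K" and "V \<in> carrier (quot_algebra A ?I)"
    then obtain x where x: "x \<in> carrier A" and V: "V = ?I +>\<^bsub>A\<^esub> x"
      by (auto simp: quot_algebra_simps A_RCOSETS_def')
    have "the_elem (?h ` (c \<odot>\<^bsub>quot_algebra A ?I\<^esub> V)) = ?h (c \<odot>\<^bsub>A\<^esub> x)"
      using c x by (simp add: V quot_smult_coset[OF sub] elem)
    also have "\<dots> = c \<odot>\<^bsub>A\<^esub> ?h x"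
      using c x e by (simp add: smult_mult_left smult_mult_right)
    finally show "the_elem (?h ` (c \<odot>\<^bsub>quot_algebra A ?I\<^esub> V))
        = c \<odot>\<^bsub>corner A e\<^esub> the_elem (?h ` V)"
      using x by (simp add: V elem corner_def)
  qed
qed

section \<open>Function spaces and free modules\<close>

lemma Maps_simps:
  "carrier (Maps S K) = S \<rightarrow>\<^sub>E carrier K"
  "mult (Maps S K) f g = (\<lambda>x\<in>S. f x \<otimes>\<^bsub>K\<^esub> g x)"
  "one (Maps S K) = (\<lambda>x\<in>S. \<one>\<^bsub>K\<^esub>)"
  "zero (Maps S K) = (\<lambda>x\<in>S. \<zero>\<^bsub>K\<^esub>)"
  "add (Maps S K) f g = (\<lambda>x\<in>S. f x \<oplus>\<^bsub>K\<^esub> g x)"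
  "smult (Maps S K) c f = (\<lambda>x\<in>S. c \<otimes>\<^bsub>K\<^esub> f x)"
  by (simp_all add: Maps_def)

lemma free_module_simps:
  "carrier (free_module I K) = {f \<in> I \<rightarrow>\<^sub>E carrier K. finite {i \<in> I. f i \<noteq> \<zero>\<^bsub>K\<^esub>}}"
  "zero (free_module I K) = (\<lambda>x\<in>I. \<zero>\<^bsub>K\<^esub>)"
  "add (free_module I K) f g = (\<lambda>x\<in>I. f x \<oplus>\<^bsub>K\<^esub> g x)"
  "smult (free_module I K) c f = (\<lambda>x\<in>I. c \<otimes>\<^bsub>K\<^esub> f x)"
  by (simp_all add: free_module_def Maps_def)

lemma Maps_mem: "\<lbrakk>f \<in> carrier (Maps S K); x \<in> S\<rbrakk> \<Longrightarrow> f x \<in> carrier K"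
  by (auto simp: Maps_simps)

lemma Maps_ext:
  "\<lbrakk>f \<in> carrier (Maps S K); g \<in> carrier (Maps S K); \<And>x. x \<in> S \<Longrightarrow> f x = g x\<rbrakk> \<Longrightarrow> f = g"
  unfolding Maps_simps by (rule PiE_ext)

lemma (in cring) Maps_module: "module R (Maps S R)"
proof -
  have closed:
    "\<And>f g. \<lbrakk>f \<in> carrier (Maps S R); g \<in> carrier (Maps S R)\<rbrakk> \<Longrightarrow> f \<oplus>\<^bsub>Maps S R\<^esub> g \<in> carrier (Maps S R)"
    "\<And>c f. \<lbrakk>c \<in> carrier R; f \<in> carrier (Maps S R)\<rbrakk> \<Longrightarrow> c \<odot>\<^bsub>Maps S R\<^esub> f \<in> carrier (Maps S R)"
    "\<And>f. f \<in> carrier (Maps S R) \<Longrightarrow> (\<lambda>x\<in>S. \<ominus> f x) \<in> carrier (Maps S R)"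
    "\<zero>\<^bsub>Maps S R\<^esub> \<in> carrier (Maps S R)"
    by (auto simp: Maps_simps)
  have eval: "(f \<oplus>\<^bsub>Maps S R\<^esub> g) x = f x \<oplus> g x" "(c \<odot>\<^bsub>Maps S R\<^esub> f) x = c \<otimes> f x"
    "\<zero>\<^bsub>Maps S R\<^esub> x = \<zero>" if "x \<in> S" for c f g x
    using that by (auto simp: Maps_simps)
  have "abelian_group (Maps S R)"
  proof (rule abelian_groupI)
    fix f assume f: "f \<in> carrier (Maps S R)"
    then show "\<exists>g\<in>carrier (Maps S R). g \<oplus>\<^bsub>Maps S R\<^esub> f = \<zero>\<^bsub>Maps S R\<^esub>"
      by (intro bexI[of _ "\<lambda>x\<in>S. \<ominus> f x"] Maps_ext[of _ S R])
        (auto simp: closed eval Maps_mem l_neg)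
  qed (auto simp: closed eval Maps_mem a_ac intro!: Maps_ext[of _ S R])
  then show ?thesis
    by (rule moduleI[OF is_cring])
      (auto simp: closed eval Maps_mem l_distr r_distr m_assoc intro!: Maps_ext[of _ S R])
qed

lemma (in cring) free_module_submodule: "submodule (carrier (free_module I R)) R (Maps I R)"
proof -
  interpret module R "Maps I R" by (rule Maps_module)
  \<comment> \<open>Closure under negation is reduced to closure under scalars.\<close>
  have inv: "\<ominus>\<^bsub>Maps I R\<^esub> f = (\<ominus> \<one>) \<odot>\<^bsub>Maps I R\<^esub> f" if "f \<in> carrier (Maps I R)" for f
    using that by (simp add: smult_l_minus)
  have mem: "f \<in> carrier (Maps I R)" if "f \<in> carrier (free_module I R)" for f
    using that by (simp add: free_module_simps Maps_simps)
  have smult: "c \<odot>\<^bsub>Maps I R\<^esub> f \<in> carrier (free_module I R)"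
    if c: "c \<in> carrier R" and f: "f \<in> carrier (free_module I R)" for c f
  proof -
    have "finite {i \<in> I. f i \<noteq> \<zero>}" using f by (simp add: free_module_simps)
    moreover have "{i \<in> I. (c \<odot>\<^bsub>Maps I R\<^esub> f) i \<noteq> \<zero>} \<subseteq> {i \<in> I. f i \<noteq> \<zero>}"
      using c by (auto simp: Maps_simps)
    ultimately have "finite {i \<in> I. (c \<odot>\<^bsub>Maps I R\<^esub> f) i \<noteq> \<zero>}" by (rule rev_finite_subset)
    then show ?thesis
      using smult_closed[OF c mem[OF f]] by (simp add: free_module_simps(1) Maps_simps(1))
  qed
  show ?thesis
  proof (rule submoduleI)
    fix f g assume f: "f \<in> carrier (free_module I R)" and g: "g \<in> carrier (free_module I R)"
    have "finite ({i \<in> I. f i \<noteq> \<zero>} \<union> {i \<in> I. g i \<noteq> \<zero>})"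
      using f g by (simp add: free_module_simps)
    moreover have "{i \<in> I. (f \<oplus>\<^bsub>Maps I R\<^esub> g) i \<noteq> \<zero>} \<subseteq> {i \<in> I. f i \<noteq> \<zero>} \<union> {i \<in> I. g i \<noteq> \<zero>}"
      by (auto simp: Maps_simps)
    ultimately have "finite {i \<in> I. (f \<oplus>\<^bsub>Maps I R\<^esub> g) i \<noteq> \<zero>}" by (rule rev_finite_subset)
    then show "f \<oplus>\<^bsub>Maps I R\<^esub> g \<in> carrier (free_module I R)"
      using M.a_closed[OF mem[OF f] mem[OF g]] by (simp add: free_module_simps(1) Maps_simps(1))
  next
    fix f assume "f \<in> carrier (free_module I R)"
    then show "\<ominus>\<^bsub>Maps I R\<^esub> f \<in> carrier (free_module I R)"
      by (simp add: inv mem smult)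
  next
    show "\<zero>\<^bsub>Maps I R\<^esub> \<in> carrier (free_module I R)"
      by (auto simp: free_module_simps Maps_simps)
  qed (auto simp: mem smult)
qed

lemma (in cring) free_module_module: "module R (free_module I R)"
  using submodule.submodule_is_module[OF free_module_submodule Maps_module]
  by (simp add: free_module_def)

lemma (in cring) indicator_closed [simp]: "indicator_map I R X \<in> carrier (Maps I R)"
  by (auto simp: indicator_map_def Maps_simps)

lemma (in cring) basis_closed: "i \<in> I \<Longrightarrow> indicator_map I R {i} \<in> carrier (free_module I R)"
  by (auto simp: indicator_map_def free_module_simps)

lemma (in cring) free_module_induct [consumes 1, case_names zero add]:
  assumes f: "f \<in> carrier (free_module I R)"
    and zero: "P \<zero>\<^bsub>free_module I R\<^esub>"
    and add: "\<And>f c i. \<lbrakk>f \<in> carrier (free_module I R); P f; c \<in> carrier R; i \<in> I\<rbrakk>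
      \<Longrightarrow> P (f \<oplus>\<^bsub>free_module I R\<^esub> c \<odot>\<^bsub>free_module I R\<^esub> indicator_map I R {i})"
  shows "P f"
proof -
  define supp where "supp f = {i \<in> I. f i \<noteq> \<zero>}" for f
  have "finite (supp f)" using f by (simp add: supp_def free_module_simps)
  then show ?thesis using f
  proof (induction "supp f" arbitrary: f rule: finite_induct)
    case empty
    then have "f = \<zero>\<^bsub>free_module I R\<^esub>"
      by (auto simp: supp_def free_module_simps fun_eq_iff PiE_def extensional_def)
    with zero show ?case by simp
  next
    case (insert i J)
    \<comment> \<open>Clearing the entry at \<open>i\<close> gives a function with support \<open>J\<close>.\<close>
    let ?g = "f(i := \<zero>)"
    have i: "i \<in> I" and fi: "f \<in> I \<rightarrow>\<^sub>E carrier R"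
      using insert by (auto simp: supp_def free_module_simps)
    have J: "J = supp ?g" using insert(2,4) by (auto simp: supp_def)
    have "?g \<in> I \<rightarrow>\<^sub>E carrier R"
      using PiE_fun_upd[of \<zero> "\<lambda>_. carrier R" i f I] fi i by (simp add: insert_absorb)
    then have g: "?g \<in> carrier (free_module I R)"
      using insert(1) unfolding J supp_def by (simp add: free_module_simps)
    have "P ?g" using insert(3)[OF J g] .
    then have "P (?g \<oplus>\<^bsub>free_module I R\<^esub> f i \<odot>\<^bsub>free_module I R\<^esub> indicator_map I R {i})"
      using PiE_mem[OF fi i] i by (intro add g)
    also have "?g \<oplus>\<^bsub>free_module I R\<^esub> f i \<odot>\<^bsub>free_module I R\<^esub> indicator_map I R {i} = f"
    proof
      fix j
      show "(?g \<oplus>\<^bsub>free_module I R\<^esub> f i \<odot>\<^bsub>free_module I R\<^esub> indicator_map I R {i}) j = f j"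
        using PiE_mem[OF fi] PiE_arb[OF fi] i
        by (cases "j \<in> I") (auto simp: free_module_simps indicator_map_def)
    qed
    finally show ?case .
  qed
qed

text \<open>
  The linear extension of a family \<open>w\<close> from a basis to the free module.
\<close>

definition free_lift ::
    "('k, 'l) ring_scheme \<Rightarrow> ('k, 'a, 'm) module_scheme \<Rightarrow> 'i set \<Rightarrow> ('i \<Rightarrow> 'a) \<Rightarrow> ('i \<Rightarrow> 'k) \<Rightarrow> 'a" where
  "free_lift K M I w f = finsum M (\<lambda>i. f i \<odot>\<^bsub>M\<^esub> w i) {i \<in> I. f i \<noteq> \<zero>\<^bsub>K\<^esub>}"

context module
begin

text \<open>
  Supports change under addition and scaling. Additivity and homogeneity are therefore proved by
  summing over a fixed finite set that contains all supports involved.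
\<close>

lemma free_lift_superset:
  assumes "w \<in> I \<rightarrow> carrier M" "f \<in> carrier (free_module I R)"
    and "finite J" "J \<subseteq> I" "{i \<in> I. f i \<noteq> \<zero>} \<subseteq> J"
  shows "free_lift R M I w f = finsum M (\<lambda>i. f i \<odot>\<^bsub>M\<^esub> w i) J"
  unfolding free_lift_def
proof (rule M.add.finprod_mono_neutral_cong_left[OF assms(3,5)])
  have mem: "f i \<in> carrier R" "w i \<in> carrier M" if "i \<in> J" for i
    using that assms(1,2,4) by (auto simp: free_module_simps)
  then show "(\<lambda>i. f i \<odot>\<^bsub>M\<^esub> w i) \<in> J \<rightarrow> carrier M" by simp
  fix i assume "i \<in> J - {i \<in> I. f i \<noteq> \<zero>}"
  then show "f i \<odot>\<^bsub>M\<^esub> w i = \<zero>\<^bsub>M\<^esub>"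
    using assms(4) mem by (auto simp: subset_iff)
qed simp

lemma free_lift_closed:
  assumes "w \<in> I \<rightarrow> carrier M" "f \<in> carrier (free_module I R)"
  shows "free_lift R M I w f \<in> carrier M"
  unfolding free_lift_def using assms
  by (intro M.finsum_closed) (auto simp: free_module_simps PiE_mem Pi_iff)

lemma free_lift_zero: "free_lift R M I w \<zero>\<^bsub>free_module I R\<^esub> = \<zero>\<^bsub>M\<^esub>"
  by (simp add: free_lift_def free_module_simps)

lemma free_lift_add:
  assumes w: "w \<in> I \<rightarrow> carrier M"
    and f: "f \<in> carrier (free_module I R)" and g: "g \<in> carrier (free_module I R)"
  shows "free_lift R M I w (f \<oplus>\<^bsub>free_module I R\<^esub> g)
       = free_lift R M I w f \<oplus>\<^bsub>M\<^esub> free_lift R M I w g"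
proof -
  interpret F: module R "free_module I R" by (rule free_module_module)
  let ?J = "{i \<in> I. f i \<noteq> \<zero>} \<union> {i \<in> I. g i \<noteq> \<zero>}"
  have fin: "finite ?J" using f g by (simp add: free_module_simps)
  have mem: "f i \<in> carrier R" "g i \<in> carrier R" "w i \<in> carrier M" if "i \<in> ?J" for i
    using that f g w by (auto simp: free_module_simps PiE_mem)
  have "free_lift R M I w (f \<oplus>\<^bsub>free_module I R\<^esub> g)
      = (\<Oplus>\<^bsub>M\<^esub>i\<in>?J. (f \<oplus>\<^bsub>free_module I R\<^esub> g) i \<odot>\<^bsub>M\<^esub> w i)"
    using w f g fin by (intro free_lift_superset F.a_closed) (auto simp: free_module_simps(3))
  also have "\<dots> = (\<Oplus>\<^bsub>M\<^esub>i\<in>?J. f i \<odot>\<^bsub>M\<^esub> w i \<oplus>\<^bsub>M\<^esub> g i \<odot>\<^bsub>M\<^esub> w i)"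
    using mem by (intro M.finsum_cong') (auto simp: free_module_simps(3) smult_l_distr)
  also have "\<dots> = (\<Oplus>\<^bsub>M\<^esub>i\<in>?J. f i \<odot>\<^bsub>M\<^esub> w i) \<oplus>\<^bsub>M\<^esub> (\<Oplus>\<^bsub>M\<^esub>i\<in>?J. g i \<odot>\<^bsub>M\<^esub> w i)"
    using mem by (intro M.finsum_addf) auto
  also have "(\<Oplus>\<^bsub>M\<^esub>i\<in>?J. f i \<odot>\<^bsub>M\<^esub> w i) = free_lift R M I w f"
    using w f fin by (intro free_lift_superset[symmetric]) auto
  also have "(\<Oplus>\<^bsub>M\<^esub>i\<in>?J. g i \<odot>\<^bsub>M\<^esub> w i) = free_lift R M I w g"
    using w g fin by (intro free_lift_superset[symmetric]) auto
  finally show ?thesis .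
qed

lemma free_lift_smult:
  assumes w: "w \<in> I \<rightarrow> carrier M" and c: "c \<in> carrier R"
    and f: "f \<in> carrier (free_module I R)"
  shows "free_lift R M I w (c \<odot>\<^bsub>free_module I R\<^esub> f) = c \<odot>\<^bsub>M\<^esub> free_lift R M I w f"
proof -
  interpret F: module R "free_module I R" by (rule free_module_module)
  let ?J = "{i \<in> I. f i \<noteq> \<zero>}"
  have fin: "finite ?J" using f by (simp add: free_module_simps)
  have mem: "f i \<in> carrier R" "w i \<in> carrier M" if "i \<in> ?J" for i
    using that f w by (auto simp: free_module_simps PiE_mem)
  have "free_lift R M I w (c \<odot>\<^bsub>free_module I R\<^esub> f)
      = (\<Oplus>\<^bsub>M\<^esub>i\<in>?J. (c \<odot>\<^bsub>free_module I R\<^esub> f) i \<odot>\<^bsub>M\<^esub> w i)"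
    using w c f fin by (intro free_lift_superset F.smult_closed) (auto simp: free_module_simps(4))
  also have "\<dots> = (\<Oplus>\<^bsub>M\<^esub>i\<in>?J. c \<odot>\<^bsub>M\<^esub> (f i \<odot>\<^bsub>M\<^esub> w i))"
    using mem c by (intro M.finsum_cong') (auto simp: free_module_simps(4) smult_assoc1)
  also have "\<dots> = c \<odot>\<^bsub>M\<^esub> free_lift R M I w f"
    unfolding free_lift_def using mem c fin by (intro finsum_smult_ldistr[symmetric]) auto
  finally show ?thesis .
qed

lemma free_lift_basis:
  assumes w: "w \<in> I \<rightarrow> carrier M" and i: "i \<in> I"
  shows "free_lift R M I w (indicator_map I R {i}) = w i"
proof -
  have "free_lift R M I w (indicator_map I R {i})
      = (\<Oplus>\<^bsub>M\<^esub>j\<in>{i}. indicator_map I R {i} j \<odot>\<^bsub>M\<^esub> w j)"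
    using w i by (intro free_lift_superset basis_closed) (auto simp: indicator_map_def)
  also have "\<dots> = w i"
    using w i by (subst M.finsum_insert) (auto simp: indicator_map_def Pi_iff)
  finally show ?thesis .
qed

end

section \<open>The tensor product of two modules\<close>

definition bilinear_map ::
    "('k, 'l) ring_scheme \<Rightarrow> ('k, 'a, 'm) module_scheme \<Rightarrow> ('k, 'b, 'n) module_scheme
     \<Rightarrow> ('k, 'c, 'o) module_scheme \<Rightarrow> ('a \<Rightarrow> 'b \<Rightarrow> 'c) \<Rightarrow> bool" where
  "bilinear_map K A B M \<phi> \<longleftrightarrow>
     (\<forall>a\<in>carrier A. \<forall>b\<in>carrier B. \<phi> a b \<in> carrier M) \<and>
     (\<forall>a\<in>carrier A. \<forall>a'\<in>carrier A. \<forall>b\<in>carrier B. \<phi> (a \<oplus>\<^bsub>A\<^esub> a') b = \<phi> a b \<oplus>\<^bsub>M\<^esub> \<phi> a' b) \<and>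
     (\<forall>a\<in>carrier A. \<forall>b\<in>carrier B. \<forall>b'\<in>carrier B. \<phi> a (b \<oplus>\<^bsub>B\<^esub> b') = \<phi> a b \<oplus>\<^bsub>M\<^esub> \<phi> a b') \<and>
     (\<forall>c\<in>carrier K. \<forall>a\<in>carrier A. \<forall>b\<in>carrier B. \<phi> (c \<odot>\<^bsub>A\<^esub> a) b = c \<odot>\<^bsub>M\<^esub> \<phi> a b) \<and>
     (\<forall>c\<in>carrier K. \<forall>a\<in>carrier A. \<forall>b\<in>carrier B. \<phi> a (c \<odot>\<^bsub>B\<^esub> b) = c \<odot>\<^bsub>M\<^esub> \<phi> a b)"

text \<open>
  The universal property of the tensor product: a bilinear map induces a map on cosets of
  formal sums. The linear extension of \<open>\<phi>\<close> is constant on each coset, so its image of a coset is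
  a singleton (\<open>tensor_lift_coset\<close> below).
\<close>

definition tensor_lift ::
    "('k, 'l) ring_scheme \<Rightarrow> ('k, 'a, 'm) module_scheme \<Rightarrow> ('k, 'b, 'n) module_scheme
     \<Rightarrow> ('k, 'c, 'o) module_scheme \<Rightarrow> ('a \<Rightarrow> 'b \<Rightarrow> 'c) \<Rightarrow> ('a \<times> 'b \<Rightarrow> 'k) set \<Rightarrow> 'c" where
  "tensor_lift K A B M \<phi> u =
     the_elem (free_lift K M (carrier A \<times> carrier B) (\<lambda>(a, b). \<phi> a b) ` u)"

text \<open>
  Inside this locale, \<open>F\<close> is the free module on pairs, \<open>p a b\<close> its basis, \<open>N\<close> the submodule of
  relations, and \<open>T = F/N\<close> the tensor product with its pure tensors \<open>t a b\<close>.
\<close>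

locale module_pair = A: module K A + B: module K B
  for K :: "('k, 'l) ring_scheme" and A :: "('k, 'a, 'm) module_scheme"
    and B :: "('k, 'b, 'n) module_scheme"
begin

abbreviation "F \<equiv> pair_module K A B"
abbreviation "p \<equiv> pair_elem K A B"
abbreviation "N \<equiv> tensor_relations K A B"
abbreviation "T \<equiv> tensor_module K A B"
abbreviation "t \<equiv> tensor K A B"

definition generating_relations :: "('a \<times> 'b \<Rightarrow> 'k) set" where
  "generating_relations =
       ({p (a \<oplus>\<^bsub>A\<^esub> a') b \<ominus>\<^bsub>F\<^esub> (p a b \<oplus>\<^bsub>F\<^esub> p a' b) | a a' b.
           a \<in> carrier A \<and> a' \<in> carrier A \<and> b \<in> carrier B} \<union>
        {p a (b \<oplus>\<^bsub>B\<^esub> b') \<ominus>\<^bsub>F\<^esub> (p a b \<oplus>\<^bsub>F\<^esub> p a b') | a b b'.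
           a \<in> carrier A \<and> b \<in> carrier B \<and> b' \<in> carrier B} \<union>
        {p (c \<odot>\<^bsub>A\<^esub> a) b \<ominus>\<^bsub>F\<^esub> c \<odot>\<^bsub>F\<^esub> p a b | c a b.
           c \<in> carrier K \<and> a \<in> carrier A \<and> b \<in> carrier B} \<union>
        {p a (c \<odot>\<^bsub>B\<^esub> b) \<ominus>\<^bsub>F\<^esub> c \<odot>\<^bsub>F\<^esub> p a b | c a b.
           c \<in> carrier K \<and> a \<in> carrier A \<and> b \<in> carrier B})"

lemma tensor_relations_eq: "N = module_span K F generating_relations"
  by (simp only: tensor_relations_def generating_relations_def Let_def)

lemma pair_module_module: "module K F"
  unfolding pair_module_def by (rule A.R.free_module_module)

sublocale F: module K F by (rule pair_module_module)

lemma pair_elem_closed [simp]: "\<lbrakk>a \<in> carrier A; b \<in> carrier B\<rbrakk> \<Longrightarrow> p a b \<in> carrier F"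
  unfolding pair_elem_def pair_module_def by (intro A.R.basis_closed) simp

lemma relations_submodule: "submodule N K F"
  unfolding tensor_relations_eq
  by (rule F.submodule_span) (auto simp: generating_relations_def)

lemma tensor_module_module: "module K T"
  unfolding tensor_module_def by (rule F.quot_module[OF relations_submodule])

sublocale T: module K T by (rule tensor_module_module)

lemma carrier_tensor_module: "carrier T = (\<lambda>f. N +>\<^bsub>F\<^esub> f) ` carrier F"
  by (auto simp: tensor_module_def quot_algebra_simps A_RCOSETS_def')

lemma add_coset:
  "\<lbrakk>f \<in> carrier F; g \<in> carrier F\<rbrakk> \<Longrightarrow> (N +>\<^bsub>F\<^esub> f) \<oplus>\<^bsub>T\<^esub> (N +>\<^bsub>F\<^esub> g) = N +>\<^bsub>F\<^esub> (f \<oplus>\<^bsub>F\<^esub> g)"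
  unfolding tensor_module_def by (rule F.quot_add_coset[OF relations_submodule])

lemma smult_coset:
  "\<lbrakk>c \<in> carrier K; f \<in> carrier F\<rbrakk> \<Longrightarrow> c \<odot>\<^bsub>T\<^esub> (N +>\<^bsub>F\<^esub> f) = N +>\<^bsub>F\<^esub> (c \<odot>\<^bsub>F\<^esub> f)"
  unfolding tensor_module_def by (rule F.quot_smult_coset[OF relations_submodule])

lemma zero_coset: "\<zero>\<^bsub>T\<^esub> = N +>\<^bsub>F\<^esub> \<zero>\<^bsub>F\<^esub>"
  using F.submoduleE(1)[OF relations_submodule]
  by (simp add: tensor_module_def quot_algebra_simps)

lemma tensor_closed [simp]: "\<lbrakk>a \<in> carrier A; b \<in> carrier B\<rbrakk> \<Longrightarrow> t a b \<in> carrier T"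
  by (simp add: tensor_def carrier_tensor_module)

lemma relation_coset:
  assumes "x \<ominus>\<^bsub>F\<^esub> y \<in> generating_relations" "x \<in> carrier F" "y \<in> carrier F"
  shows "N +>\<^bsub>F\<^esub> x = N +>\<^bsub>F\<^esub> y"
  using assms span_superset[of generating_relations K F]
  by (intro F.coset_eqI[OF relations_submodule]) (auto simp: tensor_relations_eq)

lemma bilinear_tensor: "bilinear_map K A B T t"
  unfolding bilinear_map_def
proof (intro conjI ballI)
  fix a a' b assume *: "a \<in> carrier A" "a' \<in> carrier A" "b \<in> carrier B"
  then have "p (a \<oplus>\<^bsub>A\<^esub> a') b \<ominus>\<^bsub>F\<^esub> (p a b \<oplus>\<^bsub>F\<^esub> p a' b) \<in> generating_relations"
    unfolding generating_relations_def by blast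
  then show "t (a \<oplus>\<^bsub>A\<^esub> a') b = t a b \<oplus>\<^bsub>T\<^esub> t a' b"
    using * by (simp add: tensor_def add_coset relation_coset)
next
  fix a b b' assume *: "a \<in> carrier A" "b \<in> carrier B" "b' \<in> carrier B"
  then have "p a (b \<oplus>\<^bsub>B\<^esub> b') \<ominus>\<^bsub>F\<^esub> (p a b \<oplus>\<^bsub>F\<^esub> p a b') \<in> generating_relations"
    unfolding generating_relations_def by blast
  then show "t a (b \<oplus>\<^bsub>B\<^esub> b') = t a b \<oplus>\<^bsub>T\<^esub> t a b'"
    using * by (simp add: tensor_def add_coset relation_coset)
next
  fix c a b assume *: "c \<in> carrier K" "a \<in> carrier A" "b \<in> carrier B"
  then have "p (c \<odot>\<^bsub>A\<^esub> a) b \<ominus>\<^bsub>F\<^esub> c \<odot>\<^bsub>F\<^esub> p a b \<in> generating_relations"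
    unfolding generating_relations_def by blast
  then show "t (c \<odot>\<^bsub>A\<^esub> a) b = c \<odot>\<^bsub>T\<^esub> t a b"
    using * by (simp add: tensor_def smult_coset relation_coset)
  from * have "p a (c \<odot>\<^bsub>B\<^esub> b) \<ominus>\<^bsub>F\<^esub> c \<odot>\<^bsub>F\<^esub> p a b \<in> generating_relations"
    unfolding generating_relations_def by blast
  then show "t a (c \<odot>\<^bsub>B\<^esub> b) = c \<odot>\<^bsub>T\<^esub> t a b"
    using * by (simp add: tensor_def smult_coset relation_coset)
qed simp

lemmas tensor_bilinear = bilinear_tensor[unfolded bilinear_map_def]

lemma tensor_add_left:
  "\<lbrakk>a \<in> carrier A; a' \<in> carrier A; b \<in> carrier B\<rbrakk> \<Longrightarrow> t (a \<oplus>\<^bsub>A\<^esub> a') b = t a b \<oplus>\<^bsub>T\<^esub> t a' b"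
  using tensor_bilinear by blast

lemma tensor_add_right:
  "\<lbrakk>a \<in> carrier A; b \<in> carrier B; b' \<in> carrier B\<rbrakk> \<Longrightarrow> t a (b \<oplus>\<^bsub>B\<^esub> b') = t a b \<oplus>\<^bsub>T\<^esub> t a b'"
  using tensor_bilinear by blast

lemma tensor_smult_left:
  "\<lbrakk>c \<in> carrier K; a \<in> carrier A; b \<in> carrier B\<rbrakk> \<Longrightarrow> t (c \<odot>\<^bsub>A\<^esub> a) b = c \<odot>\<^bsub>T\<^esub> t a b"
  using tensor_bilinear by blast

lemma tensor_smult_right:
  "\<lbrakk>c \<in> carrier K; a \<in> carrier A; b \<in> carrier B\<rbrakk> \<Longrightarrow> t a (c \<odot>\<^bsub>B\<^esub> b) = c \<odot>\<^bsub>T\<^esub> t a b"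
  using tensor_bilinear by blast

text \<open>
  Scalars can be absorbed into the first factor, so sums of pure tensors already exhaust the
  tensor product.
\<close>

lemma tensor_induct [consumes 1, case_names zero add]:
  assumes u: "u \<in> carrier T"
    and zero: "P \<zero>\<^bsub>T\<^esub>"
    and add: "\<And>u a b. \<lbrakk>u \<in> carrier T; P u; a \<in> carrier A; b \<in> carrier B\<rbrakk> \<Longrightarrow> P (u \<oplus>\<^bsub>T\<^esub> t a b)"
  shows "P u"
proof -
  have "P (N +>\<^bsub>F\<^esub> f)" if "f \<in> carrier F" for f
    using that unfolding pair_module_def
  proof (induction rule: A.R.free_module_induct)
    case zero
    show ?case using assms(2) by (simp add: zero_coset pair_module_def)
  next
    case (add f c i)
    obtain a b where i: "i = (a, b)" "a \<in> carrier A" "b \<in> carrier B" using add by auto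
    have f: "f \<in> carrier F" using add by (simp add: pair_module_def)
    then have "P ((N +>\<^bsub>F\<^esub> f) \<oplus>\<^bsub>T\<^esub> t (c \<odot>\<^bsub>A\<^esub> a) b)"
      using add i by (intro assms(3)) (auto simp: carrier_tensor_module pair_module_def)
    also have "(N +>\<^bsub>F\<^esub> f) \<oplus>\<^bsub>T\<^esub> t (c \<odot>\<^bsub>A\<^esub> a) b = N +>\<^bsub>F\<^esub> (f \<oplus>\<^bsub>F\<^esub> c \<odot>\<^bsub>F\<^esub> p a b)"
      using add i f by (simp add: tensor_smult_left) (simp add: tensor_def smult_coset add_coset)
    finally show ?case by (simp add: i pair_elem_def pair_module_def)
  qed
  then show ?thesis using u by (auto simp: carrier_tensor_module)
qed

end

context module_pair
begin

text \<open>
  The kernel of the linear extension is a submodule that contains the generating relations,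
  since \<open>\<phi>\<close> is bilinear; hence it contains all relations.
\<close>

lemma tensor_lift_coset:
  assumes M: "module K M" and \<phi>: "bilinear_map K A B M \<phi>" and f: "f \<in> carrier F"
  shows "tensor_lift K A B M \<phi> (N +>\<^bsub>F\<^esub> f)
       = free_lift K M (carrier A \<times> carrier B) (\<lambda>(a, b). \<phi> a b) f"
proof -
  interpret M: module K M by (rule M)
  define L where "L = free_lift K M (carrier A \<times> carrier B) (\<lambda>(a, b). \<phi> a b)"
  have w: "(\<lambda>(a, b). \<phi> a b) \<in> carrier A \<times> carrier B \<rightarrow> carrier M"
    using \<phi> by (auto simp: bilinear_map_def)
  have L_closed: "L f \<in> carrier M" if "f \<in> carrier F" for f
    using that w unfolding L_def pair_module_def by (intro M.free_lift_closed)
  have L_add: "L (f \<oplus>\<^bsub>F\<^esub> g) = L f \<oplus>\<^bsub>M\<^esub> L g" if "f \<in> carrier F" "g \<in> carrier F" for f g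
    using that w unfolding L_def pair_module_def by (intro M.free_lift_add)
  have L_smult: "L (c \<odot>\<^bsub>F\<^esub> f) = c \<odot>\<^bsub>M\<^esub> L f" if "c \<in> carrier K" "f \<in> carrier F" for c f
    using that w unfolding L_def pair_module_def by (intro M.free_lift_smult)
  have L_zero: "L \<zero>\<^bsub>F\<^esub> = \<zero>\<^bsub>M\<^esub>"
    unfolding L_def pair_module_def by (rule M.free_lift_zero)
  have L_inv: "L (\<ominus>\<^bsub>F\<^esub> f) = \<ominus>\<^bsub>M\<^esub> L f" if "f \<in> carrier F" for f
    using that L_add[of "\<ominus>\<^bsub>F\<^esub> f" f] L_zero L_closed
    by (intro M.minus_equality[symmetric]) (simp_all add: F.M.l_neg)
  have L_pair: "L (p a b) = \<phi> a b" if "a \<in> carrier A" "b \<in> carrier B" for a b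
    using M.free_lift_basis[OF w, of "(a, b)"] that by (simp add: L_def pair_elem_def)
  let ?Ker = "{f \<in> carrier F. L f = \<zero>\<^bsub>M\<^esub>}"
  have L_diff: "L (x \<ominus>\<^bsub>F\<^esub> y) = L x \<ominus>\<^bsub>M\<^esub> L y" if "x \<in> carrier F" "y \<in> carrier F" for x y
    using that by (simp add: a_minus_def L_add L_inv)
  have self_diff: "x \<ominus>\<^bsub>M\<^esub> x = \<zero>\<^bsub>M\<^esub>" if "x \<in> carrier M" for x
    using that by (simp add: a_minus_def M.M.r_neg)
  have "submodule ?Ker K F"
    by (rule F.submoduleI) (auto simp: L_zero L_inv L_add L_smult)
  moreover have "generating_relations \<subseteq> ?Ker"
    unfolding generating_relations_def using \<phi>
    by (auto simp: L_diff L_add L_smult L_pair bilinear_map_def self_diff)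
  ultimately have "N \<subseteq> ?Ker"
    unfolding tensor_relations_eq by (rule span_least)
  then have "L ` (N +>\<^bsub>F\<^esub> f) \<subseteq> {L f}"
    using f L_closed by (auto simp: a_r_coset_def' L_add subset_iff)
  moreover have "f \<in> N +>\<^bsub>F\<^esub> f"
    using subgroup.one_closed[OF submodule.axioms(1)[OF relations_submodule]] f
    by (force simp: a_r_coset_def')
  ultimately have "L ` (N +>\<^bsub>F\<^esub> f) = {L f}" by blast
  then show ?thesis by (simp add: tensor_lift_def L_def)
qed

context
  fixes M :: "('k, 'c, 'o) module_scheme" and \<phi>
  assumes M: "module K M" and \<phi>: "bilinear_map K A B M \<phi>"
begin

interpretation M: module K M by (rule M)

lemma lift_domain: "(\<lambda>(a, b). \<phi> a b) \<in> carrier A \<times> carrier B \<rightarrow> carrier M"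
  using \<phi> by (auto simp: bilinear_map_def)

lemma tensor_lift_closed: "u \<in> carrier T \<Longrightarrow> tensor_lift K A B M \<phi> u \<in> carrier M"
  using M.free_lift_closed[OF lift_domain]
  by (auto simp: carrier_tensor_module tensor_lift_coset[OF M \<phi>] pair_module_def[symmetric])

lemma tensor_lift_add:
  assumes "u \<in> carrier T" "v \<in> carrier T"
  shows "tensor_lift K A B M \<phi> (u \<oplus>\<^bsub>T\<^esub> v) = tensor_lift K A B M \<phi> u \<oplus>\<^bsub>M\<^esub> tensor_lift K A B M \<phi> v"
  using assms M.free_lift_add[OF lift_domain]
  by (auto simp: carrier_tensor_module tensor_lift_coset[OF M \<phi>] add_coset pair_module_def[symmetric])

lemma tensor_lift_smult:
  assumes "c \<in> carrier K" "u \<in> carrier T"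
  shows "tensor_lift K A B M \<phi> (c \<odot>\<^bsub>T\<^esub> u) = c \<odot>\<^bsub>M\<^esub> tensor_lift K A B M \<phi> u"
  using assms M.free_lift_smult[OF lift_domain]
  by (auto simp: carrier_tensor_module tensor_lift_coset[OF M \<phi>] smult_coset pair_module_def[symmetric])

lemma tensor_lift_tensor:
  assumes "a \<in> carrier A" "b \<in> carrier B"
  shows "tensor_lift K A B M \<phi> (t a b) = \<phi> a b"
  using assms M.free_lift_basis[OF lift_domain, of "(a, b)"]
  by (simp add: tensor_def tensor_lift_coset[OF M \<phi>]) (simp add: pair_elem_def)

lemma tensor_lift_zero: "tensor_lift K A B M \<phi> \<zero>\<^bsub>T\<^esub> = \<zero>\<^bsub>M\<^esub>"
  using tensor_lift_smult[of "\<zero>\<^bsub>K\<^esub>" "\<zero>\<^bsub>T\<^esub>"] tensor_lift_closed[of "\<zero>\<^bsub>T\<^esub>"] by simp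

end

lemma tensor_as_finsum:
  assumes "u \<in> carrier T"
  shows "\<exists>n::nat. \<exists>a b. a \<in> {..<n} \<rightarrow> carrier A \<and> b \<in> {..<n} \<rightarrow> carrier B
          \<and> u = (\<Oplus>\<^bsub>T\<^esub>i\<in>{..<n}. t (a i) (b i))"
  using assms
proof (induction rule: tensor_induct)
  case zero
  show ?case by (intro exI[of _ 0]) simp
next
  case (add u a0 b0)
  then obtain n :: nat and a b where a: "a \<in> {..<n} \<rightarrow> carrier A" and b: "b \<in> {..<n} \<rightarrow> carrier B"
    and u: "u = (\<Oplus>\<^bsub>T\<^esub>i\<in>{..<n}. t (a i) (b i))" by blast
  let ?a = "a(n := a0)" and ?b = "b(n := b0)"
  have "(\<Oplus>\<^bsub>T\<^esub>i\<in>{..<n}. t (?a i) (?b i)) = u"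
    unfolding u using a b by (intro T.finsum_cong') (auto simp: Pi_iff)
  then have "u \<oplus>\<^bsub>T\<^esub> t a0 b0 = (\<Oplus>\<^bsub>T\<^esub>i\<in>{..<Suc n}. t (?a i) (?b i))"
    using a b add by (subst lessThan_Suc, subst T.finsum_insert) (auto simp: Pi_iff T.a_comm)
  moreover have "?a \<in> {..<Suc n} \<rightarrow> carrier A" "?b \<in> {..<Suc n} \<rightarrow> carrier B"
    using a b add by (auto simp: Pi_iff less_Suc_eq)
  ultimately show ?case by blast
qed

lemma tensor_finsum_left:
  assumes "finite J" "a \<in> J \<rightarrow> carrier A" "b \<in> carrier B"
  shows "t (\<Oplus>\<^bsub>A\<^esub>i\<in>J. a i) b = (\<Oplus>\<^bsub>T\<^esub>i\<in>J. t (a i) b)"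
  using assms
proof (induction J rule: finite_induct)
  case empty
  have "t \<zero>\<^bsub>A\<^esub> b = t (\<zero>\<^bsub>K\<^esub> \<odot>\<^bsub>A\<^esub> \<zero>\<^bsub>A\<^esub>) b" by simp
  also have "\<dots> = \<zero>\<^bsub>T\<^esub>" using empty(2) by (subst tensor_smult_left) auto
  finally show ?case by simp
next
  case (insert i J)
  then show ?case by (simp add: Pi_iff tensor_add_left)
qed

end

section \<open>Tensor products with a function space\<close>

text \<open>
  The tensor product \<open>A \<otimes> Maps(S, K)\<close> maps to functions \<open>S \<rightarrow> A\<close> by sending \<open>a \<otimes> b\<close> to
  \<open>x \<mapsto> b(x) a\<close>. Over a field this map is injective, which turns identities between tensors into
  pointwise identities in \<open>A\<close>.
\<close>

locale function_tensor = field K + A: module K A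
  for K :: "('k, 'l) ring_scheme" and A :: "('k, 'a, 'm) module_scheme" +
  fixes S :: "'s set"
begin

sublocale module_pair K A "Maps S K"
  by (intro module_pair.intro A.module_axioms Maps_module)

abbreviation "B \<equiv> Maps S K"

definition eval :: "'s \<Rightarrow> ('a \<times> ('s \<Rightarrow> 'k) \<Rightarrow> 'k) set \<Rightarrow> 'a" where
  "eval x = tensor_lift K A B A (\<lambda>a b. b x \<odot>\<^bsub>A\<^esub> a)"

lemma eval_bilinear:
  assumes "x \<in> S"
  shows "bilinear_map K A B A (\<lambda>a b. b x \<odot>\<^bsub>A\<^esub> a)"
proof -
  have mem: "b x \<in> carrier K" if "b \<in> carrier B" for b using that assms by (rule Maps_mem)
  show ?thesis
    using assms unfolding bilinear_map_def
    by (auto simp: mem A.smult_r_distr A.smult_l_distr Maps_simps(5,6) A.smult_assoc1)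
      (metis A.smult_assoc1 m_comm mem)
qed

context
  fixes x assumes x: "x \<in> S"
begin

lemma eval_closed: "u \<in> carrier T \<Longrightarrow> eval x u \<in> carrier A"
  unfolding eval_def by (rule tensor_lift_closed[OF A.module_axioms eval_bilinear[OF x]])

lemma eval_add: "\<lbrakk>u \<in> carrier T; v \<in> carrier T\<rbrakk> \<Longrightarrow> eval x (u \<oplus>\<^bsub>T\<^esub> v) = eval x u \<oplus>\<^bsub>A\<^esub> eval x v"
  unfolding eval_def by (rule tensor_lift_add[OF A.module_axioms eval_bilinear[OF x]])

lemma eval_smult: "\<lbrakk>c \<in> carrier K; u \<in> carrier T\<rbrakk> \<Longrightarrow> eval x (c \<odot>\<^bsub>T\<^esub> u) = c \<odot>\<^bsub>A\<^esub> eval x u"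
  unfolding eval_def by (rule tensor_lift_smult[OF A.module_axioms eval_bilinear[OF x]])

lemma eval_tensor: "\<lbrakk>a \<in> carrier A; b \<in> carrier B\<rbrakk> \<Longrightarrow> eval x (t a b) = b x \<odot>\<^bsub>A\<^esub> a"
  unfolding eval_def by (rule tensor_lift_tensor[OF A.module_axioms eval_bilinear[OF x]])

lemma eval_zero: "eval x \<zero>\<^bsub>T\<^esub> = \<zero>\<^bsub>A\<^esub>"
  unfolding eval_def by (rule tensor_lift_zero[OF A.module_axioms eval_bilinear[OF x]])

lemma eval_finsum:
  assumes "finite J" "f \<in> J \<rightarrow> carrier T"
  shows "eval x (\<Oplus>\<^bsub>T\<^esub>i\<in>J. f i) = (\<Oplus>\<^bsub>A\<^esub>i\<in>J. eval x (f i))"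
  using assms
  by (induction J rule: finite_induct) (simp_all add: eval_zero eval_add eval_closed Pi_iff)

end

text \<open>
  Induction on the number of summands. If the last function \<open>b\<^sub>n\<close> is nonzero at some point \<open>x\<close>,
  vanishing at \<open>x\<close> expresses \<open>a\<^sub>n\<close> as a combination \<open>\<Sum>\<^sub>i c\<^sub>i a\<^sub>i\<close> of the other \<open>a\<^sub>i\<close>. Substituting this
  rewrites the same tensor as \<open>\<Sum>\<^sub>i a\<^sub>i \<otimes> (b\<^sub>i + c\<^sub>i b\<^sub>n)\<close> with one summand less.
\<close>

lemma eval_eq_zero_finsum:
  fixes n :: nat
  assumes "a \<in> {..<n} \<rightarrow> carrier A" "b \<in> {..<n} \<rightarrow> carrier B"
    and "\<And>x. x \<in> S \<Longrightarrow> eval x (\<Oplus>\<^bsub>T\<^esub>i\<in>{..<n}. t (a i) (b i)) = \<zero>\<^bsub>A\<^esub>"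
  shows "(\<Oplus>\<^bsub>T\<^esub>i\<in>{..<n}. t (a i) (b i)) = \<zero>\<^bsub>T\<^esub>"
  using assms
proof (induction n arbitrary: b)
  case 0
  show ?case by simp
next
  case (Suc n b)
  have mem: "a i \<in> carrier A" "b i \<in> carrier B" if "i \<le> n" for i
    using Suc.prems that by (auto simp: Pi_iff)
  have mem': "a i \<in> carrier A" "b i \<in> carrier B" if "i < n" for i
    using mem that by auto
  let ?u = "\<Oplus>\<^bsub>T\<^esub>i\<in>{..<Suc n}. t (a i) (b i)"
  let ?s = "\<Oplus>\<^bsub>T\<^esub>i\<in>{..<n}. t (a i) (b i)"
  have s: "?s \<in> carrier T" using mem' by (intro T.finsum_closed) auto
  have split: "?u = ?s \<oplus>\<^bsub>T\<^esub> t (a n) (b n)"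
    using mem mem' by (subst lessThan_Suc, subst T.finsum_insert) (auto simp: T.a_comm s)
  have "\<exists>b'. b' \<in> {..<n} \<rightarrow> carrier B \<and> ?u = (\<Oplus>\<^bsub>T\<^esub>i\<in>{..<n}. t (a i) (b' i))"
  proof (cases "\<exists>x\<in>S. b n x \<noteq> \<zero>\<^bsub>K\<^esub>")
    case False
    then have "b n = \<zero>\<^bsub>B\<^esub>"
      using mem by (intro Maps_ext[of _ S K]) (auto simp: Maps_simps(1,4))
    also have "\<dots> = \<zero>\<^bsub>K\<^esub> \<odot>\<^bsub>B\<^esub> \<zero>\<^bsub>B\<^esub>" by simp
    finally have "t (a n) (b n) = \<zero>\<^bsub>T\<^esub>"
      using mem tensor_smult_right[of "\<zero>\<^bsub>K\<^esub>" "a n" "\<zero>\<^bsub>B\<^esub>"] by simp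
    then show ?thesis using mem' s split by (intro exI[of _ b]) auto
  next
    case True
    then obtain x where x: "x \<in> S" and nz: "b n x \<noteq> \<zero>\<^bsub>K\<^esub>" by blast
    have val: "b i x \<in> carrier K" if "i \<le> n" for i using mem(2)[OF that] x by (rule Maps_mem)
    then have unit: "b n x \<in> Units K" using nz by (simp add: field_Units)
    define d where "d = \<ominus>\<^bsub>K\<^esub> (inv\<^bsub>K\<^esub> (b n x))"
    have d: "d \<in> carrier K" using unit by (simp add: d_def)
    define c where "c i = d \<otimes>\<^bsub>K\<^esub> b i x" for i
    have c: "c i \<in> carrier K" if "i < n" for i using that d val by (simp add: c_def)
    let ?r = "\<Oplus>\<^bsub>A\<^esub>i\<in>{..<n}. b i x \<odot>\<^bsub>A\<^esub> a i"
    have r: "?r \<in> carrier A" using mem' val by (intro A.M.finsum_closed) auto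
    \<comment> \<open>The relation at \<open>x\<close> is solved for \<open>a n\<close>.\<close>
    have "eval x ?s = ?r"
      using mem' val x by (subst eval_finsum) (auto intro!: A.M.finsum_cong' simp: eval_tensor)
    then have "?r \<oplus>\<^bsub>A\<^esub> b n x \<odot>\<^bsub>A\<^esub> a n = \<zero>\<^bsub>A\<^esub>"
      using Suc.prems(3)[OF x] x s mem by (simp add: split eval_add eval_tensor)
    then have "?r = \<ominus>\<^bsub>A\<^esub> (b n x \<odot>\<^bsub>A\<^esub> a n)"
      using r mem val by (intro A.minus_equality[symmetric]) auto
    then have "d \<odot>\<^bsub>A\<^esub> ?r = (d \<otimes>\<^bsub>K\<^esub> (\<ominus>\<^bsub>K\<^esub> b n x)) \<odot>\<^bsub>A\<^esub> a n"
      using d mem val by (simp add: A.smult_assoc1 A.smult_l_minus)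
    also have "d \<otimes>\<^bsub>K\<^esub> (\<ominus>\<^bsub>K\<^esub> b n x) = \<one>\<^bsub>K\<^esub>"
      using unit val by (simp add: d_def l_minus r_minus)
    finally have "a n = d \<odot>\<^bsub>A\<^esub> ?r" using mem by simp
    also have "\<dots> = (\<Oplus>\<^bsub>A\<^esub>i\<in>{..<n}. d \<odot>\<^bsub>A\<^esub> (b i x \<odot>\<^bsub>A\<^esub> a i))"
      using d mem' val by (intro A.finsum_smult_ldistr) auto
    also have "\<dots> = (\<Oplus>\<^bsub>A\<^esub>i\<in>{..<n}. c i \<odot>\<^bsub>A\<^esub> a i)"
      using d mem' val by (intro A.M.finsum_cong') (auto simp: c_def A.smult_assoc1)
    finally have an: "a n = (\<Oplus>\<^bsub>A\<^esub>i\<in>{..<n}. c i \<odot>\<^bsub>A\<^esub> a i)" .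
    have "t (a n) (b n) = (\<Oplus>\<^bsub>T\<^esub>i\<in>{..<n}. t (c i \<odot>\<^bsub>A\<^esub> a i) (b n))"
      unfolding an using mem mem' c by (intro tensor_finsum_left) auto
    also have "\<dots> = (\<Oplus>\<^bsub>T\<^esub>i\<in>{..<n}. t (a i) (c i \<odot>\<^bsub>B\<^esub> b n))"
      using mem mem' c by (intro T.finsum_cong') (auto simp: tensor_smult_left tensor_smult_right)
    finally have "?u = (\<Oplus>\<^bsub>T\<^esub>i\<in>{..<n}. t (a i) (b i) \<oplus>\<^bsub>T\<^esub> t (a i) (c i \<odot>\<^bsub>B\<^esub> b n))"
      using mem mem' c by (subst T.finsum_addf) (auto simp: split)
    also have "\<dots> = (\<Oplus>\<^bsub>T\<^esub>i\<in>{..<n}. t (a i) (b i \<oplus>\<^bsub>B\<^esub> c i \<odot>\<^bsub>B\<^esub> b n))"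
      using mem mem' c by (intro T.finsum_cong') (auto simp: tensor_add_right)
    finally show ?thesis
      using mem mem' c by (intro exI[of _ "\<lambda>i. b i \<oplus>\<^bsub>B\<^esub> c i \<odot>\<^bsub>B\<^esub> b n"]) auto
  qed
  then obtain b' where b': "b' \<in> {..<n} \<rightarrow> carrier B"
    and u: "?u = (\<Oplus>\<^bsub>T\<^esub>i\<in>{..<n}. t (a i) (b' i))" by blast
  show ?case
    unfolding u using Suc.prems(3) b' mem' by (intro Suc.IH) (auto simp: u)
qed

lemma eval_injective:
  assumes "u \<in> carrier T" "v \<in> carrier T" and eq: "\<And>x. x \<in> S \<Longrightarrow> eval x u = eval x v"
  shows "u = v"
proof -
  have w: "u \<ominus>\<^bsub>T\<^esub> v \<in> carrier T" using assms by simp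
  then obtain n :: nat and a b where "a \<in> {..<n} \<rightarrow> carrier A" "b \<in> {..<n} \<rightarrow> carrier B"
    and "u \<ominus>\<^bsub>T\<^esub> v = (\<Oplus>\<^bsub>T\<^esub>i\<in>{..<n}. t (a i) (b i))"
    using tensor_as_finsum by blast
  moreover have u: "u = (u \<ominus>\<^bsub>T\<^esub> v) \<oplus>\<^bsub>T\<^esub> v"
    using assms by (simp add: a_minus_def T.a_assoc T.M.l_neg)
  moreover have "eval x (u \<ominus>\<^bsub>T\<^esub> v) = \<zero>\<^bsub>A\<^esub>" if x: "x \<in> S" for x
  proof -
    from u have "eval x v = eval x (u \<ominus>\<^bsub>T\<^esub> v) \<oplus>\<^bsub>A\<^esub> eval x v"
      using eval_add[OF x w assms(2)] eq[OF x] by simp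
    then show ?thesis
      using eval_closed[OF x] w assms(2) by simp
  qed
  ultimately have "u \<ominus>\<^bsub>T\<^esub> v = \<zero>\<^bsub>T\<^esub>" using eval_eq_zero_finsum by simp
  with u show ?thesis using assms by simp
qed

end

section \<open>Homogeneous components\<close>

context graded_algebra
begin

definition component :: "'a \<Rightarrow> 'g \<Rightarrow> 'a" where
  "component y = (THE c. c \<in> (\<Pi>\<^sub>E g\<in>carrier G. Agr g) \<and>
     finite {g \<in> carrier G. c g \<noteq> \<zero>\<^bsub>A\<^esub>} \<and>
     y = finsum A c {g \<in> carrier G. c g \<noteq> \<zero>\<^bsub>A\<^esub>})"

abbreviation support :: "'a \<Rightarrow> 'g set" where
  "support y \<equiv> {g \<in> carrier G. component y g \<noteq> \<zero>\<^bsub>A\<^esub>}"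

lemma homogeneous_carrier: "\<lbrakk>g \<in> carrier G; a \<in> Agr g\<rbrakk> \<Longrightarrow> a \<in> carrier A"
  using submoduleE(1)[OF component_submodule] by blast

lemma homogeneous_zero: "g \<in> carrier G \<Longrightarrow> \<zero>\<^bsub>A\<^esub> \<in> Agr g"
  using subgroup.one_closed[OF submodule.axioms(1)[OF component_submodule]] by simp

lemma component_decomposition:
  assumes "y \<in> carrier A"
  shows "component y \<in> (\<Pi>\<^sub>E g\<in>carrier G. Agr g)" "finite (support y)"
    "y = finsum A (component y) (support y)"
  using theI'[OF direct_sum[OF assms]] unfolding component_def by blast+

lemma component_mem: "\<lbrakk>y \<in> carrier A; g \<in> carrier G\<rbrakk> \<Longrightarrow> component y g \<in> Agr g"
  using component_decomposition(1) by (rule PiE_mem)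

lemma component_closed [simp]: "\<lbrakk>y \<in> carrier A; g \<in> carrier G\<rbrakk> \<Longrightarrow> component y g \<in> carrier A"
  using homogeneous_carrier component_mem by blast

text \<open>
  Any finite decomposition into homogeneous elements of distinct degrees computes the components.
\<close>

lemma component_unique:
  assumes J: "finite J" "J \<subseteq> carrier G" and d: "\<And>g. g \<in> J \<Longrightarrow> d g \<in> Agr g"
    and y: "y = finsum A d J" and h: "h \<in> carrier G"
  shows "component y h = (if h \<in> J then d h else \<zero>\<^bsub>A\<^esub>)"
proof -
  \<comment> \<open>The uniqueness of decompositions speaks about functions on all degrees whose support
    is exactly the set of nonzero entries, so \<open>d\<close> is extended by zero first.\<close>
  let ?d = "\<lambda>g\<in>carrier G. if g \<in> J then d g else \<zero>\<^bsub>A\<^esub>"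
  let ?supp = "{g \<in> carrier G. ?d g \<noteq> \<zero>\<^bsub>A\<^esub>}"
  have dA: "d g \<in> carrier A" if "g \<in> J" for g
    using d[OF that] homogeneous_carrier J that by blast
  have Y: "y \<in> carrier A" using dA unfolding y by (intro M.finsum_closed) auto
  have supp: "?supp \<subseteq> J" by auto
  have "finsum A ?d ?supp = finsum A d J"
    using J dA supp by (intro M.add.finprod_mono_neutral_cong_left) auto
  then have "?d \<in> (\<Pi>\<^sub>E g\<in>carrier G. Agr g) \<and> finite ?supp \<and> y = finsum A ?d ?supp"
    using d homogeneous_zero finite_subset[OF supp J(1)] y by auto
  moreover have "component y \<in> (\<Pi>\<^sub>E g\<in>carrier G. Agr g) \<and> finite (support y)
      \<and> y = finsum A (component y) (support y)"
    using component_decomposition[OF Y] by blast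
  ultimately have "component y = ?d"
    using direct_sum[OF Y] by blast
  then show ?thesis using h by simp
qed

lemma component_superset:
  assumes "y \<in> carrier A" "finite J" "support y \<subseteq> J" "J \<subseteq> carrier G"
  shows "y = finsum A (component y) J"
proof -
  have "finsum A (component y) (support y) = finsum A (component y) J"
    using assms by (intro M.add.finprod_mono_neutral_cong_left) auto
  then show ?thesis using component_decomposition(3)[OF assms(1)] by simp
qed

lemma component_add:
  assumes y: "y \<in> carrier A" and z: "z \<in> carrier A" and h: "h \<in> carrier G"
  shows "component (y \<oplus>\<^bsub>A\<^esub> z) h = component y h \<oplus>\<^bsub>A\<^esub> component z h"
proof -
  let ?J = "insert h (support y \<union> support z)"
  have J: "finite ?J" "?J \<subseteq> carrier G"
    using component_decomposition(2) y z h by auto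
  have "finsum A (component y) ?J = y" "finsum A (component z) ?J = z"
    using J y z by (auto intro!: component_superset[symmetric])
  then have "y \<oplus>\<^bsub>A\<^esub> z = finsum A (component y) ?J \<oplus>\<^bsub>A\<^esub> finsum A (component z) ?J"
    by (simp only:)
  also have "\<dots> = finsum A (\<lambda>g. component y g \<oplus>\<^bsub>A\<^esub> component z g) ?J"
    using J(2) y z by (intro M.finsum_addf[symmetric]) auto
  finally have "y \<oplus>\<^bsub>A\<^esub> z = finsum A (\<lambda>g. component y g \<oplus>\<^bsub>A\<^esub> component z g) ?J" .
  moreover have "component y g \<oplus>\<^bsub>A\<^esub> component z g \<in> Agr g" if "g \<in> ?J" for g
  proof -
    have g: "g \<in> carrier G" using J(2) that by blast
    show ?thesis
      using submoduleE(5)[OF component_submodule[OF g]] component_mem[OF y g] component_mem[OF z g]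
      by blast
  qed
  ultimately show ?thesis
    using component_unique[OF J] h by simp
qed

lemma component_smult:
  assumes y: "y \<in> carrier A" and c: "c \<in> carrier K" and h: "h \<in> carrier G"
  shows "component (c \<odot>\<^bsub>A\<^esub> y) h = c \<odot>\<^bsub>A\<^esub> component y h"
proof -
  let ?J = "insert h (support y)"
  have J: "finite ?J" "?J \<subseteq> carrier G"
    using component_decomposition(2) y h by auto
  have "finsum A (component y) ?J = y"
    using J y by (auto intro!: component_superset[symmetric])
  then have "c \<odot>\<^bsub>A\<^esub> y = c \<odot>\<^bsub>A\<^esub> finsum A (component y) ?J"
    by (simp only:)
  also have "\<dots> = finsum A (\<lambda>g. c \<odot>\<^bsub>A\<^esub> component y g) ?J"
    using J y c by (intro finsum_smult_ldistr) auto
  finally have "c \<odot>\<^bsub>A\<^esub> y = finsum A (\<lambda>g. c \<odot>\<^bsub>A\<^esub> component y g) ?J" .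
  moreover have "c \<odot>\<^bsub>A\<^esub> component y g \<in> Agr g" if "g \<in> ?J" for g
    using submoduleE(4)[OF component_submodule] c component_mem[OF y] J(2) that by blast
  ultimately show ?thesis
    using component_unique[OF J] h by simp
qed

lemma component_homogeneous:
  assumes "g \<in> carrier G" "a \<in> Agr g" "h \<in> carrier G"
  shows "component a h = (if h = g then a else \<zero>\<^bsub>A\<^esub>)"
  using component_unique[of "{g}" "\<lambda>_. a" a h] assms homogeneous_carrier[of g a] by simp

text \<open>
  For fixed \<open>x\<close> and \<open>f \<gamma> = ev\<^bsub>\<gamma>x\<^esub>(u)\<close> this is the value at \<open>x\<close> of the crossed product of \<open>u\<close> with a tensor
  that has value \<open>y\<close> there.
\<close>

definition graded_sum :: "('g \<Rightarrow> 'a) \<Rightarrow> 'a \<Rightarrow> 'a" where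
  "graded_sum f y = (\<Oplus>\<^bsub>A\<^esub>g\<in>support y. f g \<otimes>\<^bsub>A\<^esub> component y g)"

lemma graded_sum_superset:
  assumes f: "f \<in> carrier G \<rightarrow> carrier A" and y: "y \<in> carrier A"
    and J: "finite J" "support y \<subseteq> J" "J \<subseteq> carrier G"
  shows "graded_sum f y = (\<Oplus>\<^bsub>A\<^esub>g\<in>J. f g \<otimes>\<^bsub>A\<^esub> component y g)"
proof -
  have "f g \<in> carrier A" if "g \<in> J" for g using f J that by blast
  then show ?thesis unfolding graded_sum_def
    using y J by (intro M.add.finprod_mono_neutral_cong_left) auto
qed

lemma graded_sum_cong:
  assumes "\<And>g. g \<in> carrier G \<Longrightarrow> f g = f' g" "f' \<in> carrier G \<rightarrow> carrier A" "y \<in> carrier A"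
  shows "graded_sum f y = graded_sum f' y"
  unfolding graded_sum_def using assms by (intro M.finsum_cong') auto

lemma graded_sum_closed:
  assumes "f \<in> carrier G \<rightarrow> carrier A" "y \<in> carrier A"
  shows "graded_sum f y \<in> carrier A"
  unfolding graded_sum_def using assms by (intro M.finsum_closed) auto

lemma graded_sum_add_right:
  assumes f: "f \<in> carrier G \<rightarrow> carrier A" and y: "y \<in> carrier A" and z: "z \<in> carrier A"
  shows "graded_sum f (y \<oplus>\<^bsub>A\<^esub> z) = graded_sum f y \<oplus>\<^bsub>A\<^esub> graded_sum f z"
proof -
  let ?J = "support y \<union> support z"
  have J: "finite ?J" "?J \<subseteq> carrier G"
    using component_decomposition(2) y z by auto
  have fA: "f g \<in> carrier A" "component y g \<in> carrier A" "component z g \<in> carrier A"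
    if "g \<in> ?J" for g using f y z J(2) that by auto
  have "graded_sum f (y \<oplus>\<^bsub>A\<^esub> z) = (\<Oplus>\<^bsub>A\<^esub>g\<in>?J. f g \<otimes>\<^bsub>A\<^esub> component (y \<oplus>\<^bsub>A\<^esub> z) g)"
    using f y z J by (intro graded_sum_superset) (auto simp: component_add)
  also have "\<dots> = (\<Oplus>\<^bsub>A\<^esub>g\<in>?J. f g \<otimes>\<^bsub>A\<^esub> component y g \<oplus>\<^bsub>A\<^esub> f g \<otimes>\<^bsub>A\<^esub> component z g)"
    using y z fA by (intro M.finsum_cong') (auto simp: component_add r_distr)
  also have "\<dots> = (\<Oplus>\<^bsub>A\<^esub>g\<in>?J. f g \<otimes>\<^bsub>A\<^esub> component y g) \<oplus>\<^bsub>A\<^esub> (\<Oplus>\<^bsub>A\<^esub>g\<in>?J. f g \<otimes>\<^bsub>A\<^esub> component z g)"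
    using fA by (intro M.finsum_addf) auto
  also have "(\<Oplus>\<^bsub>A\<^esub>g\<in>?J. f g \<otimes>\<^bsub>A\<^esub> component y g) = graded_sum f y"
    using f y J by (intro graded_sum_superset[symmetric]) auto
  also have "(\<Oplus>\<^bsub>A\<^esub>g\<in>?J. f g \<otimes>\<^bsub>A\<^esub> component z g) = graded_sum f z"
    using f z J by (intro graded_sum_superset[symmetric]) auto
  finally show ?thesis .
qed

lemma graded_sum_smult_right:
  assumes f: "f \<in> carrier G \<rightarrow> carrier A" and y: "y \<in> carrier A" and c: "c \<in> carrier K"
  shows "graded_sum f (c \<odot>\<^bsub>A\<^esub> y) = c \<odot>\<^bsub>A\<^esub> graded_sum f y"
proof -
  let ?J = "support y"
  have J: "finite ?J" "?J \<subseteq> carrier G"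
    using component_decomposition(2) y by auto
  have "graded_sum f (c \<odot>\<^bsub>A\<^esub> y) = (\<Oplus>\<^bsub>A\<^esub>g\<in>?J. f g \<otimes>\<^bsub>A\<^esub> component (c \<odot>\<^bsub>A\<^esub> y) g)"
    using f y c J by (intro graded_sum_superset) (auto simp: component_smult)
  also have "\<dots> = (\<Oplus>\<^bsub>A\<^esub>g\<in>?J. c \<odot>\<^bsub>A\<^esub> (f g \<otimes>\<^bsub>A\<^esub> component y g))"
    using f y c by (intro M.finsum_cong') (auto simp: component_smult smult_mult_right Pi_iff)
  also have "\<dots> = c \<odot>\<^bsub>A\<^esub> graded_sum f y"
    unfolding graded_sum_def using f y c J by (intro finsum_smult_ldistr[symmetric]) auto
  finally show ?thesis .
qed

lemma graded_sum_add_left: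
  assumes "f \<in> carrier G \<rightarrow> carrier A" "f' \<in> carrier G \<rightarrow> carrier A" "y \<in> carrier A"
  shows "graded_sum (\<lambda>g. f g \<oplus>\<^bsub>A\<^esub> f' g) y = graded_sum f y \<oplus>\<^bsub>A\<^esub> graded_sum f' y"
proof -
  have "graded_sum (\<lambda>g. f g \<oplus>\<^bsub>A\<^esub> f' g) y
      = (\<Oplus>\<^bsub>A\<^esub>g\<in>support y. f g \<otimes>\<^bsub>A\<^esub> component y g \<oplus>\<^bsub>A\<^esub> f' g \<otimes>\<^bsub>A\<^esub> component y g)"
    unfolding graded_sum_def
    using assms by (intro M.finsum_cong') (auto simp: l_distr Pi_iff)
  also have "\<dots> = graded_sum f y \<oplus>\<^bsub>A\<^esub> graded_sum f' y"
    unfolding graded_sum_def using assms by (intro M.finsum_addf) auto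
  finally show ?thesis .
qed

lemma graded_sum_smult_left:
  assumes "f \<in> carrier G \<rightarrow> carrier A" "y \<in> carrier A" "c \<in> carrier K"
  shows "graded_sum (\<lambda>g. c \<odot>\<^bsub>A\<^esub> f g) y = c \<odot>\<^bsub>A\<^esub> graded_sum f y"
proof -
  have "graded_sum (\<lambda>g. c \<odot>\<^bsub>A\<^esub> f g) y
      = (\<Oplus>\<^bsub>A\<^esub>g\<in>support y. c \<odot>\<^bsub>A\<^esub> (f g \<otimes>\<^bsub>A\<^esub> component y g))"
    unfolding graded_sum_def
    using assms by (intro M.finsum_cong') (auto simp: smult_mult_left Pi_iff)
  also have "\<dots> = c \<odot>\<^bsub>A\<^esub> graded_sum f y"
    unfolding graded_sum_def using assms component_decomposition(2)
    by (intro finsum_smult_ldistr[symmetric]) auto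
  finally show ?thesis .
qed

lemma graded_sum_homogeneous:
  assumes f: "f \<in> carrier G \<rightarrow> carrier A" and g: "g \<in> carrier G" and a: "a \<in> Agr g"
  shows "graded_sum f a = f g \<otimes>\<^bsub>A\<^esub> a"
proof -
  have aA: "a \<in> carrier A" "f g \<in> carrier A" using homogeneous_carrier f g a by blast+
  have "graded_sum f a = (\<Oplus>\<^bsub>A\<^esub>h\<in>{g}. f h \<otimes>\<^bsub>A\<^esub> component a h)"
    using f g a aA
    by (intro graded_sum_superset) (auto simp: component_homogeneous split: if_splits)
  also have "\<dots> = f g \<otimes>\<^bsub>A\<^esub> a"
    using f g a aA by (subst M.finsum_insert) (auto simp: component_homogeneous)
  finally show ?thesis .
qed

end

section \<open>The crossed product is an associative algebra\<close>

locale graded_action = function_tensor K A S + Gr: graded_algebra K G A Agr +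
    Act: left_monoid_action G S act
  for K :: "('k, 'l) ring_scheme" and A :: "('k, 'a, 'm) module_scheme" and S :: "'s set"
    and G :: "('g, 'n) monoid_scheme" and Agr :: "'g \<Rightarrow> 'a set" and act :: "'g \<Rightarrow> 's \<Rightarrow> 's"
begin

text \<open>
  The crossed multiplication is prescribed only for right factors \<open>a \<otimes> b\<close> with \<open>a\<close> homogeneous.
  Splitting \<open>a\<close> into its components shows that these tensors still span.
\<close>

lemma homogeneous_tensor_induct [consumes 1, case_names zero add]:
  assumes u: "u \<in> carrier T"
    and zero: "P \<zero>\<^bsub>T\<^esub>"
    and add: "\<And>u g a b. \<lbrakk>u \<in> carrier T; P u; g \<in> carrier G; a \<in> Agr g; a \<in> carrier A; b \<in> carrier B\<rbrakk>
      \<Longrightarrow> P (u \<oplus>\<^bsub>T\<^esub> t a b)"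
  shows "P u"
  using u
proof (induction rule: tensor_induct)
  case zero
  show ?case by (rule assms(2))
next
  case (add u a b)
  let ?c = "Gr.component a"
  have *: "P (u \<oplus>\<^bsub>T\<^esub> (\<Oplus>\<^bsub>T\<^esub>g\<in>J. t (?c g) b))" if "finite J" "J \<subseteq> carrier G" for J
    using that
  proof (induction J rule: finite_induct)
    case empty
    then show ?case using add by simp
  next
    case (insert g J)
    have c: "?c h \<in> Agr h \<and> ?c h \<in> carrier A" if "h \<in> insert g J" for h
      using that insert.prems add Gr.component_mem by auto
    then have s: "(\<Oplus>\<^bsub>T\<^esub>g\<in>J. t (?c g) b) \<in> carrier T"
      using add by (intro T.finsum_closed) auto
    have "P ((u \<oplus>\<^bsub>T\<^esub> (\<Oplus>\<^bsub>T\<^esub>g\<in>J. t (?c g) b)) \<oplus>\<^bsub>T\<^esub> t (?c g) b)"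
      using insert c s add.hyps by (intro assms(3)) auto
    also have "(u \<oplus>\<^bsub>T\<^esub> (\<Oplus>\<^bsub>T\<^esub>g\<in>J. t (?c g) b)) \<oplus>\<^bsub>T\<^esub> t (?c g) b = u \<oplus>\<^bsub>T\<^esub> (\<Oplus>\<^bsub>T\<^esub>g\<in>insert g J. t (?c g) b)"
      using insert(1,2) c s add.hyps by (subst T.finsum_insert) (auto simp: T.a_ac)
    finally show ?case .
  qed
  have "t a b = t (finsum A ?c (Gr.support a)) b"
    using Gr.component_decomposition(3)[OF add.hyps(2)] by simp
  also have "\<dots> = (\<Oplus>\<^bsub>T\<^esub>g\<in>Gr.support a. t (?c g) b)"
    using add Gr.component_decomposition(2) by (intro tensor_finsum_left) auto
  finally show ?case
    using *[of "Gr.support a"] Gr.component_decomposition(2)[OF add.hyps(2)] by auto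
qed

lemma translate_closed [simp]:
  "\<lbrakk>b \<in> carrier B; g \<in> carrier G\<rbrakk> \<Longrightarrow> translate S act b g \<in> carrier B"
  using Act.act_closed by (auto simp: translate_def Maps_simps(1))

lemma Maps_mult_closed [simp]:
  "\<lbrakk>b \<in> carrier B; b' \<in> carrier B\<rbrakk> \<Longrightarrow> b \<otimes>\<^bsub>B\<^esub> b' \<in> carrier B"
  by (auto simp: Maps_simps(1,2))

definition crossed_eval ::
    "('a \<times> ('s \<Rightarrow> 'k) \<Rightarrow> 'k) set \<Rightarrow> ('a \<times> ('s \<Rightarrow> 'k) \<Rightarrow> 'k) set \<Rightarrow> 's \<Rightarrow> 'a" where
  "crossed_eval u v x = Gr.graded_sum (\<lambda>g. eval (act g x) u) (eval x v)"

lemma eval_translate_closed: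
  "\<lbrakk>u \<in> carrier T; x \<in> S\<rbrakk> \<Longrightarrow> (\<lambda>g. eval (act g x) u) \<in> carrier G \<rightarrow> carrier A"
  using Act.act_closed eval_closed by auto

lemma crossed_eval_closed:
  "\<lbrakk>u \<in> carrier T; v \<in> carrier T; x \<in> S\<rbrakk> \<Longrightarrow> crossed_eval u v x \<in> carrier A"
  unfolding crossed_eval_def
  by (intro Gr.graded_sum_closed eval_translate_closed eval_closed)

lemma crossed_eval_add_right:
  "\<lbrakk>u \<in> carrier T; v \<in> carrier T; w \<in> carrier T; x \<in> S\<rbrakk>
   \<Longrightarrow> crossed_eval u (v \<oplus>\<^bsub>T\<^esub> w) x = crossed_eval u v x \<oplus>\<^bsub>A\<^esub> crossed_eval u w x"
  by (simp add: crossed_eval_def eval_add eval_closed eval_translate_closed Gr.graded_sum_add_right)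

lemma crossed_eval_smult_right:
  "\<lbrakk>u \<in> carrier T; v \<in> carrier T; c \<in> carrier K; x \<in> S\<rbrakk>
   \<Longrightarrow> crossed_eval u (c \<odot>\<^bsub>T\<^esub> v) x = c \<odot>\<^bsub>A\<^esub> crossed_eval u v x"
  by (simp add: crossed_eval_def eval_smult eval_closed eval_translate_closed
      Gr.graded_sum_smult_right)

lemma crossed_eval_add_left:
  assumes "u \<in> carrier T" "v \<in> carrier T" "w \<in> carrier T" "x \<in> S"
  shows "crossed_eval (u \<oplus>\<^bsub>T\<^esub> v) w x = crossed_eval u w x \<oplus>\<^bsub>A\<^esub> crossed_eval v w x"
proof -
  have "Gr.graded_sum (\<lambda>g. eval (act g x) (u \<oplus>\<^bsub>T\<^esub> v)) (eval x w)
      = Gr.graded_sum (\<lambda>g. eval (act g x) u \<oplus>\<^bsub>A\<^esub> eval (act g x) v) (eval x w)"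
    using assms Act.act_closed by (intro Gr.graded_sum_cong) (auto simp: eval_add eval_closed)
  then show ?thesis
    using assms by (simp add: crossed_eval_def eval_closed eval_translate_closed Gr.graded_sum_add_left)
qed

lemma crossed_eval_smult_left:
  assumes "u \<in> carrier T" "c \<in> carrier K" "w \<in> carrier T" "x \<in> S"
  shows "crossed_eval (c \<odot>\<^bsub>T\<^esub> u) w x = c \<odot>\<^bsub>A\<^esub> crossed_eval u w x"
proof -
  have "Gr.graded_sum (\<lambda>g. eval (act g x) (c \<odot>\<^bsub>T\<^esub> u)) (eval x w)
      = Gr.graded_sum (\<lambda>g. c \<odot>\<^bsub>A\<^esub> eval (act g x) u) (eval x w)"
    using assms Act.act_closed by (intro Gr.graded_sum_cong) (auto simp: eval_smult eval_closed)
  then show ?thesis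
    using assms by (simp add: crossed_eval_def eval_closed eval_translate_closed Gr.graded_sum_smult_left)
qed

lemma crossed_eval_zero:
  assumes "u \<in> carrier T" "x \<in> S"
  shows "crossed_eval u \<zero>\<^bsub>T\<^esub> x = \<zero>\<^bsub>A\<^esub>" "crossed_eval \<zero>\<^bsub>T\<^esub> u x = \<zero>\<^bsub>A\<^esub>"
  using crossed_eval_smult_right[of u "\<zero>\<^bsub>T\<^esub>" "\<zero>\<^bsub>K\<^esub>" x] crossed_eval_smult_left[of "\<zero>\<^bsub>T\<^esub>" "\<zero>\<^bsub>K\<^esub>" u x]
    crossed_eval_closed[of u "\<zero>\<^bsub>T\<^esub>" x] crossed_eval_closed[of "\<zero>\<^bsub>T\<^esub>" u x] assms
  by simp_all

text \<open>
  For \<open>y\<close> homogeneous of degree \<open>\<gamma>\<close> only the summand of index \<open>\<gamma>\<close> survives, and the values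
  \<open>b(\<gamma>x) b'(x)\<close> are those of \<open>b\<^sup>\<gamma> b'\<close>.
\<close>

lemma crossed_eval_tensor:
  assumes g: "g \<in> carrier G" and a: "a \<in> carrier A" and a': "a' \<in> Agr g"
    and b: "b \<in> carrier B" and b': "b' \<in> carrier B" and x: "x \<in> S"
  shows "crossed_eval (t a b) (t a' b') x = eval x (t (a \<otimes>\<^bsub>A\<^esub> a') (translate S act b g \<otimes>\<^bsub>B\<^esub> b'))"
proof -
  have a'A: "a' \<in> carrier A" using Gr.homogeneous_carrier g a' by blast
  have gx: "act g x \<in> S" using Act.act_closed g x by blast
  have val: "b (act g x) \<in> carrier K" "b' x \<in> carrier K"
    using Maps_mem[OF b gx] Maps_mem[OF b' x] .
  have hom: "b' x \<odot>\<^bsub>A\<^esub> a' \<in> Agr g"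
    using A.submoduleE(4)[OF Gr.component_submodule[OF g] val(2) a'] .
  have "crossed_eval (t a b) (t a' b') x = Gr.graded_sum (\<lambda>g. eval (act g x) (t a b)) (b' x \<odot>\<^bsub>A\<^esub> a')"
    unfolding crossed_eval_def eval_tensor[OF x a'A b'] ..
  also have "\<dots> = eval (act g x) (t a b) \<otimes>\<^bsub>A\<^esub> (b' x \<odot>\<^bsub>A\<^esub> a')"
    using eval_translate_closed[OF tensor_closed[OF a b] x] g hom by (rule Gr.graded_sum_homogeneous)
  also have "\<dots> = (b (act g x) \<odot>\<^bsub>A\<^esub> a) \<otimes>\<^bsub>A\<^esub> (b' x \<odot>\<^bsub>A\<^esub> a')"
    unfolding eval_tensor[OF gx a b] ..
  also have "\<dots> = (b (act g x) \<otimes>\<^bsub>K\<^esub> b' x) \<odot>\<^bsub>A\<^esub> (a \<otimes>\<^bsub>A\<^esub> a')"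
    using val a a'A
    by (simp add: Gr.smult_mult_left[of "b (act g x)" a "b' x \<odot>\<^bsub>A\<^esub> a'"]
        Gr.smult_mult_right[of "b' x" a a'] A.smult_assoc1)
  also have "b (act g x) \<otimes>\<^bsub>K\<^esub> b' x = (translate S act b g \<otimes>\<^bsub>B\<^esub> b') x"
    using x by (simp add: Maps_simps(2) translate_def)
  also have "\<dots> \<odot>\<^bsub>A\<^esub> (a \<otimes>\<^bsub>A\<^esub> a') = eval x (t (a \<otimes>\<^bsub>A\<^esub> a') (translate S act b g \<otimes>\<^bsub>B\<^esub> b'))"
    using a a'A b b' g x by (intro eval_tensor[symmetric]) simp_all
  finally show ?thesis .
qed

text \<open>
  The tensors \<open>u\<close> and \<open>v\<close> for which the prescribed values are attained by a tensor are closed under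
  sums in either argument, so it suffices to treat generators, where
  \<open>crossed_eval_tensor\<close> gives the tensor explicitly.
\<close>

lemma crossed_product_exists:
  assumes u: "u \<in> carrier T" and v: "v \<in> carrier T"
  shows "\<exists>w\<in>carrier T. \<forall>x\<in>S. eval x w = crossed_eval u v x"
  using v
proof (induction rule: homogeneous_tensor_induct)
  case zero
  show ?case using u by (intro bexI[of _ "\<zero>\<^bsub>T\<^esub>"]) (auto simp: eval_zero crossed_eval_zero)
next
  case (add v g a' b')
  note gen = add.hyps(2-5)
  have "\<exists>w\<in>carrier T. \<forall>x\<in>S. eval x w = crossed_eval u (t a' b') x"
    using u
  proof (induction rule: tensor_induct)
    case zero
    show ?case using gen by (intro bexI[of _ "\<zero>\<^bsub>T\<^esub>"]) (auto simp: eval_zero crossed_eval_zero)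
  next
    case (add u a b)
    then obtain w where "w \<in> carrier T" "\<forall>x\<in>S. eval x w = crossed_eval u (t a' b') x" by blast
    then show ?case
      using add gen
      by (intro bexI[of _ "w \<oplus>\<^bsub>T\<^esub> t (a \<otimes>\<^bsub>A\<^esub> a') (translate S act b g \<otimes>\<^bsub>B\<^esub> b')"])
        (auto simp: eval_add crossed_eval_add_left crossed_eval_tensor[of g])
  qed
  then obtain w where "w \<in> carrier T" "\<forall>x\<in>S. eval x w = crossed_eval u (t a' b') x" by blast
  moreover from add obtain w' where "w' \<in> carrier T" "\<forall>x\<in>S. eval x w' = crossed_eval u v x" by blast
  ultimately show ?case
    using u add.hyps(1) gen
    by (intro bexI[of _ "w' \<oplus>\<^bsub>T\<^esub> w"]) (auto simp: eval_add crossed_eval_add_right)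
qed

text \<open>
  Every required identity holds after evaluation at each \<open>x\<close>, and evaluations separate tensors.
\<close>

lemma is_crossed_mult_exists: "\<exists>m. is_crossed_mult K G A Agr S act m"
proof -
  obtain m where m: "\<And>u v. \<lbrakk>u \<in> carrier T; v \<in> carrier T\<rbrakk> \<Longrightarrow>
      m u v \<in> carrier T \<and> (\<forall>x\<in>S. eval x (m u v) = crossed_eval u v x)"
    using crossed_product_exists by metis
  have ext: "m u v = w" if "u \<in> carrier T" "v \<in> carrier T" "w \<in> carrier T"
    "\<And>x. x \<in> S \<Longrightarrow> crossed_eval u v x = eval x w" for u v w
    using that m by (intro eval_injective) auto
  have "is_crossed_mult K G A Agr S act m"
    unfolding is_crossed_mult_def bilinear_op_def Let_def
  proof (intro conjI ballI)
    fix g a a' b b'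
    assume gen: "g \<in> carrier G" "a \<in> carrier A" "a' \<in> Agr g" "b \<in> carrier B" "b' \<in> carrier B"
    then have "a' \<in> carrier A" using Gr.homogeneous_carrier by blast
    then show "m (t a b) (t a' b') = t (a \<otimes>\<^bsub>A\<^esub> a') (translate S act b g \<otimes>\<^bsub>B\<^esub> b')"
      using gen by (intro ext crossed_eval_tensor) simp_all
  next
    fix u v assume "u \<in> carrier T" "v \<in> carrier T"
    then show "m u v \<in> carrier T" using m by blast
  next
    fix u v w assume uvw: "u \<in> carrier T" "v \<in> carrier T" "w \<in> carrier T"
    show "m (u \<oplus>\<^bsub>T\<^esub> v) w = m u w \<oplus>\<^bsub>T\<^esub> m v w"
      by (rule ext) (simp_all add: uvw m eval_add crossed_eval_add_left)
    show "m w (u \<oplus>\<^bsub>T\<^esub> v) = m w u \<oplus>\<^bsub>T\<^esub> m w v"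
      by (rule ext) (simp_all add: uvw m eval_add crossed_eval_add_right)
  next
    fix c u v assume cuv: "c \<in> carrier K" "u \<in> carrier T" "v \<in> carrier T"
    show "m (c \<odot>\<^bsub>T\<^esub> u) v = c \<odot>\<^bsub>T\<^esub> m u v"
      by (rule ext) (simp_all add: cuv m eval_smult crossed_eval_smult_left)
    show "m u (c \<odot>\<^bsub>T\<^esub> v) = c \<odot>\<^bsub>T\<^esub> m u v"
      by (rule ext) (simp_all add: cuv m eval_smult crossed_eval_smult_right)
  qed
  then show ?thesis by blast
qed

abbreviation "C \<equiv> crossed_product K G A Agr S act"

lemma is_crossed_mult_C: "is_crossed_mult K G A Agr S act (mult C)"
  using someI_ex[OF is_crossed_mult_exists] by (simp add: crossed_product_def)

lemma C_simps:
  "carrier C = carrier T" "add C = add T" "zero C = zero T" "smult C = smult T"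
  "\<one>\<^bsub>C\<^esub> = t \<one>\<^bsub>A\<^esub> \<one>\<^bsub>B\<^esub>"
  by (simp_all add: crossed_product_def)

lemma C_bilinear: "bilinear_op K T (mult C)"
  using is_crossed_mult_C by (simp add: is_crossed_mult_def Let_def)

lemma C_mult_closed: "\<lbrakk>u \<in> carrier T; v \<in> carrier T\<rbrakk> \<Longrightarrow> u \<otimes>\<^bsub>C\<^esub> v \<in> carrier T"
  using C_bilinear unfolding bilinear_op_def by blast

lemma C_l_distr:
  "\<lbrakk>u \<in> carrier T; v \<in> carrier T; w \<in> carrier T\<rbrakk>
   \<Longrightarrow> (u \<oplus>\<^bsub>T\<^esub> v) \<otimes>\<^bsub>C\<^esub> w = (u \<otimes>\<^bsub>C\<^esub> w) \<oplus>\<^bsub>T\<^esub> (v \<otimes>\<^bsub>C\<^esub> w)"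
  using C_bilinear unfolding bilinear_op_def by blast

lemma C_r_distr:
  "\<lbrakk>u \<in> carrier T; v \<in> carrier T; w \<in> carrier T\<rbrakk>
   \<Longrightarrow> w \<otimes>\<^bsub>C\<^esub> (u \<oplus>\<^bsub>T\<^esub> v) = (w \<otimes>\<^bsub>C\<^esub> u) \<oplus>\<^bsub>T\<^esub> (w \<otimes>\<^bsub>C\<^esub> v)"
  using C_bilinear unfolding bilinear_op_def by blast

lemma C_smult:
  "\<lbrakk>c \<in> carrier K; u \<in> carrier T; v \<in> carrier T\<rbrakk> \<Longrightarrow> (c \<odot>\<^bsub>T\<^esub> u) \<otimes>\<^bsub>C\<^esub> v = c \<odot>\<^bsub>T\<^esub> (u \<otimes>\<^bsub>C\<^esub> v)"
  "\<lbrakk>c \<in> carrier K; u \<in> carrier T; v \<in> carrier T\<rbrakk> \<Longrightarrow> u \<otimes>\<^bsub>C\<^esub> (c \<odot>\<^bsub>T\<^esub> v) = c \<odot>\<^bsub>T\<^esub> (u \<otimes>\<^bsub>C\<^esub> v)"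
  using C_bilinear unfolding bilinear_op_def by blast+

lemma C_mult_tensor:
  "\<lbrakk>a' \<in> Agr g; g \<in> carrier G; a \<in> carrier A; b \<in> carrier B; b' \<in> carrier B\<rbrakk>
   \<Longrightarrow> t a b \<otimes>\<^bsub>C\<^esub> t a' b' = t (a \<otimes>\<^bsub>A\<^esub> a') (translate S act b g \<otimes>\<^bsub>B\<^esub> b')"
  using is_crossed_mult_C unfolding is_crossed_mult_def Let_def by blast

lemma C_null: "u \<in> carrier T \<Longrightarrow> \<zero>\<^bsub>T\<^esub> \<otimes>\<^bsub>C\<^esub> u = \<zero>\<^bsub>T\<^esub>" "u \<in> carrier T \<Longrightarrow> u \<otimes>\<^bsub>C\<^esub> \<zero>\<^bsub>T\<^esub> = \<zero>\<^bsub>T\<^esub>"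
  using C_smult[of "\<zero>\<^bsub>K\<^esub>" "\<zero>\<^bsub>T\<^esub>" u] C_smult[of "\<zero>\<^bsub>K\<^esub>" u "\<zero>\<^bsub>T\<^esub>"] C_mult_closed by simp_all

lemma Maps_one_closed [simp]: "\<one>\<^bsub>B\<^esub> \<in> carrier B"
  by (auto simp: Maps_simps(1,3))

text \<open>
  In degree \<open>\<gamma>\<delta>\<close> the action satisfies \<open>b\<^bsup>\<gamma>\<delta>\<^esup> = (b\<^sup>\<gamma>)\<^sup>\<delta>\<close>, and \<open>b \<mapsto> b\<^sup>\<delta>\<close> is multiplicative.
\<close>

lemma C_assoc_generators:
  assumes "a \<in> carrier A" "b \<in> carrier B"
    and "g \<in> carrier G" "a' \<in> Agr g" "b' \<in> carrier B"
    and "h \<in> carrier G" "a'' \<in> Agr h" "b'' \<in> carrier B"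
  shows "(t a b \<otimes>\<^bsub>C\<^esub> t a' b') \<otimes>\<^bsub>C\<^esub> t a'' b'' = t a b \<otimes>\<^bsub>C\<^esub> (t a' b' \<otimes>\<^bsub>C\<^esub> t a'' b'')"
proof -
  have mem: "a' \<in> carrier A" "a'' \<in> carrier A" "a' \<otimes>\<^bsub>A\<^esub> a'' \<in> Agr (g \<otimes>\<^bsub>G\<^esub> h)" "g \<otimes>\<^bsub>G\<^esub> h \<in> carrier G"
    using assms Gr.homogeneous_carrier Gr.component_mult by auto
  have "translate S act (translate S act b g \<otimes>\<^bsub>B\<^esub> b') h \<otimes>\<^bsub>B\<^esub> b''
      = translate S act b (g \<otimes>\<^bsub>G\<^esub> h) \<otimes>\<^bsub>B\<^esub> (translate S act b' h \<otimes>\<^bsub>B\<^esub> b'')"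
    using assms Act.act_closed
    by (intro Maps_ext[of _ S K])
      (auto simp: mem, auto simp: translate_def Maps_simps(2) Act.act_mult Maps_mem m_assoc)
  moreover have "a \<otimes>\<^bsub>A\<^esub> a' \<otimes>\<^bsub>A\<^esub> a'' = a \<otimes>\<^bsub>A\<^esub> (a' \<otimes>\<^bsub>A\<^esub> a'')"
    using assms mem by (intro monoid.m_assoc[OF ring.is_monoid[OF Gr.ring_axioms]])
  ultimately show ?thesis
    using assms mem by (simp add: C_mult_tensor)
qed

lemma C_assoc:
  assumes u: "u \<in> carrier T" and v: "v \<in> carrier T" and w: "w \<in> carrier T"
  shows "(u \<otimes>\<^bsub>C\<^esub> v) \<otimes>\<^bsub>C\<^esub> w = u \<otimes>\<^bsub>C\<^esub> (v \<otimes>\<^bsub>C\<^esub> w)"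
  using w
proof (induction rule: homogeneous_tensor_induct)
  case zero
  show ?case using u v by (simp add: C_null C_mult_closed)
next
  case (add w h a'' b'')
  note w = add.hyps(1) add.IH and gen'' = add.hyps(2-5)
  have "(u \<otimes>\<^bsub>C\<^esub> v) \<otimes>\<^bsub>C\<^esub> t a'' b'' = u \<otimes>\<^bsub>C\<^esub> (v \<otimes>\<^bsub>C\<^esub> t a'' b'')"
    using v
  proof (induction rule: homogeneous_tensor_induct)
    case zero
    show ?case using u gen'' by (simp add: C_null C_mult_closed)
  next
    case (add v g a' b')
    note v = add.hyps(1) add.IH and gen' = add.hyps(2-5)
    have "(u \<otimes>\<^bsub>C\<^esub> t a' b') \<otimes>\<^bsub>C\<^esub> t a'' b'' = u \<otimes>\<^bsub>C\<^esub> (t a' b' \<otimes>\<^bsub>C\<^esub> t a'' b'')"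
      using u
    proof (induction rule: tensor_induct)
      case zero
      show ?case using gen' gen'' by (simp add: C_null C_mult_closed)
    next
      case (add u a b)
      have "(t a b \<otimes>\<^bsub>C\<^esub> t a' b') \<otimes>\<^bsub>C\<^esub> t a'' b'' = t a b \<otimes>\<^bsub>C\<^esub> (t a' b' \<otimes>\<^bsub>C\<^esub> t a'' b'')"
        using add.hyps gen' gen'' by (intro C_assoc_generators[of a b g a' b' h a'' b''])
      then show ?case using add gen' gen''
        by (simp add: C_l_distr C_mult_closed)
    qed
    then show ?case using u v gen' gen'' by (simp add: C_l_distr C_r_distr C_mult_closed)
  qed
  then show ?case using u v w gen'' by (simp add: C_r_distr C_mult_closed)
qed

lemma C_one:
  assumes "u \<in> carrier T"
  shows "\<one>\<^bsub>C\<^esub> \<otimes>\<^bsub>C\<^esub> u = u" "u \<otimes>\<^bsub>C\<^esub> \<one>\<^bsub>C\<^esub> = u"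
proof -
  have one: "\<one>\<^bsub>A\<^esub> \<in> Agr \<one>\<^bsub>G\<^esub>" "\<one>\<^bsub>G\<^esub> \<in> carrier G" using Gr.component_one by auto
  have "\<one>\<^bsub>C\<^esub> \<otimes>\<^bsub>C\<^esub> u = u \<and> u \<otimes>\<^bsub>C\<^esub> \<one>\<^bsub>C\<^esub> = u"
    using assms
  proof (induction rule: homogeneous_tensor_induct)
    case zero
    show ?case by (simp add: C_null C_simps)
  next
    case (add u g a b)
    have "translate S act \<one>\<^bsub>B\<^esub> g \<otimes>\<^bsub>B\<^esub> b = b"
    proof (rule Maps_ext[of _ S K])
      fix x assume "x \<in> S"
      then show "(translate S act \<one>\<^bsub>B\<^esub> g \<otimes>\<^bsub>B\<^esub> b) x = b x"
        using add.hyps Act.act_closed Maps_mem[of b S K x]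
        by (simp add: translate_def Maps_simps(2,3))
    qed (use add.hyps in simp_all)
    moreover have "translate S act b \<one>\<^bsub>G\<^esub> \<otimes>\<^bsub>B\<^esub> \<one>\<^bsub>B\<^esub> = b"
    proof (rule Maps_ext[of _ S K])
      fix x assume "x \<in> S"
      then show "(translate S act b \<one>\<^bsub>G\<^esub> \<otimes>\<^bsub>B\<^esub> \<one>\<^bsub>B\<^esub>) x = b x"
        using add.hyps Maps_mem[of b S K x]
        by (simp add: translate_def Maps_simps(2,3) Act.act_one)
    qed (use add.hyps one in simp_all)
    ultimately have "\<one>\<^bsub>C\<^esub> \<otimes>\<^bsub>C\<^esub> t a b = t a b" "t a b \<otimes>\<^bsub>C\<^esub> \<one>\<^bsub>C\<^esub> = t a b"
      using add one by (simp_all add: C_simps C_mult_tensor)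
    then show ?case using add by (simp add: C_simps C_l_distr C_r_distr)
  qed
  then show "\<one>\<^bsub>C\<^esub> \<otimes>\<^bsub>C\<^esub> u = u" "u \<otimes>\<^bsub>C\<^esub> \<one>\<^bsub>C\<^esub> = u" by blast+
qed

lemma C_one_closed: "\<one>\<^bsub>C\<^esub> \<in> carrier T"
  by (simp add: C_simps)

lemma C_module: "module K C"
proof -
  have "add_monoid C = add_monoid T" by (simp add: C_simps)
  then have "abelian_group C"
    using T.abelian_group_axioms
    by (simp add: abelian_group_def abelian_monoid_def abelian_group_axioms_def)
  then show ?thesis
    by (rule moduleI[OF is_cring])
      (simp_all add: C_simps(1-4) T.smult_l_distr T.smult_r_distr T.smult_assoc1)
qed

lemma C_assoc_algebra: "assoc_algebra K C"
proof -
  interpret C: module K C by (rule C_module)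
  have "monoid C"
    by (rule monoidI) (simp_all add: C_simps(1) C_assoc C_one C_mult_closed C_one_closed)
  then have "ring C"
    by (intro ringI C.M.abelian_group_axioms) (simp_all add: C_simps(1-4) C_l_distr C_r_distr)
  then show ?thesis
    by (intro assoc_algebra.intro C_module assoc_algebra_axioms.intro) (simp_all add: C_simps(1-4) C_smult)
qed

section \<open>Indicator functions of convex sets\<close>

abbreviation "\<chi> X \<equiv> indicator_map S K X"

lemma chi_eq: "chi K A S X = t \<one>\<^bsub>A\<^esub> (\<chi> X)"
  by (simp add: chi_def)

lemma chi_closed: "chi K A S X \<in> carrier T"
  by (simp add: chi_eq)

lemma chi_idempotent: "chi K A S X \<otimes>\<^bsub>C\<^esub> chi K A S X = chi K A S X"
proof -
  have "translate S act (\<chi> X) \<one>\<^bsub>G\<^esub> \<otimes>\<^bsub>B\<^esub> \<chi> X = \<chi> X"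
    by (auto simp: fun_eq_iff translate_def Maps_simps(2) indicator_map_def Act.act_one)
  then show ?thesis
    using Gr.component_one by (simp add: chi_eq C_mult_tensor)
qed

lemma chi_complement:
  assumes "X \<subseteq> S"
  shows "chi K A S X \<oplus>\<^bsub>T\<^esub> chi K A S (S - X) = \<one>\<^bsub>C\<^esub>"
proof -
  have "\<chi> X \<oplus>\<^bsub>B\<^esub> \<chi> (S - X) = \<one>\<^bsub>B\<^esub>"
    by (auto simp: fun_eq_iff Maps_simps(3,5) indicator_map_def)
  then show ?thesis
    by (simp add: chi_eq C_simps tensor_add_right[symmetric])
qed

text \<open>
  This is the step that uses convexity: writing \<open>g\<close> and \<open>h\<close> for the degrees of \<open>a\<close> and \<open>a'\<close>, the
  function in the second factor can be nonzero at \<open>x\<close> only if \<open>x\<close> and \<open>ghx\<close> lie in \<open>X\<close> while the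
  intermediate point \<open>hx\<close> does not.
\<close>

lemma chi_vanish_generators:
  assumes X: "act_convex G S act X"
    and g: "g \<in> carrier G" "a \<in> Agr g" "b \<in> carrier B"
    and h: "h \<in> carrier G" "a' \<in> Agr h" "b' \<in> carrier B"
  shows "chi K A S X \<otimes>\<^bsub>C\<^esub> t a b \<otimes>\<^bsub>C\<^esub> chi K A S (S - X) \<otimes>\<^bsub>C\<^esub> t a' b' \<otimes>\<^bsub>C\<^esub> chi K A S X = \<zero>\<^bsub>T\<^esub>"
proof -
  have one: "\<one>\<^bsub>A\<^esub> \<in> Agr \<one>\<^bsub>G\<^esub>" "\<one>\<^bsub>G\<^esub> \<in> carrier G" using Gr.component_one by auto
  have A: "a \<in> carrier A" "a' \<in> carrier A" using Gr.homogeneous_carrier g h by auto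
  define f where "f = translate S act (translate S act (translate S act (translate S act (\<chi> X) g \<otimes>\<^bsub>B\<^esub> b) \<one>\<^bsub>G\<^esub>
    \<otimes>\<^bsub>B\<^esub> \<chi> (S - X)) h \<otimes>\<^bsub>B\<^esub> b') \<one>\<^bsub>G\<^esub> \<otimes>\<^bsub>B\<^esub> \<chi> X"
  have f: "f \<in> carrier B" using g h one by (simp add: f_def)
  have "f = \<zero>\<^bsub>B\<^esub>"
  proof (rule Maps_ext[of _ S K])
    fix x assume x: "x \<in> S"
    have S: "act h x \<in> S" "act g (act h x) \<in> S" using Act.act_closed g h x by auto
    have val: "b (act h x) \<in> carrier K" "b' x \<in> carrier K"
      using Maps_mem[OF g(3) S(1)] Maps_mem[OF h(3) x] .
    have "f x = \<chi> X (act g (act h x)) \<otimes>\<^bsub>K\<^esub> b (act h x) \<otimes>\<^bsub>K\<^esub> \<chi> (S - X) (act h x) \<otimes>\<^bsub>K\<^esub> b' x \<otimes>\<^bsub>K\<^esub> \<chi> X x"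
      using x S by (simp add: f_def translate_def Maps_simps(2) Act.act_one)
    moreover have "x \<notin> X \<or> act h x \<in> X \<or> act g (act h x) \<notin> X"
      using X S g(1) h(1) unfolding act_convex_def act_le_def by blast
    ultimately show "f x = \<zero>\<^bsub>B\<^esub> x"
      using x S val by (auto simp: indicator_map_def Maps_simps(4))
  qed (use f in simp_all)
  moreover have "t a'' \<zero>\<^bsub>B\<^esub> = \<zero>\<^bsub>T\<^esub>" if "a'' \<in> carrier A" for a''
    using tensor_smult_right[of "\<zero>\<^bsub>K\<^esub>" a'' "\<zero>\<^bsub>B\<^esub>"] that by simp
  moreover have "chi K A S X \<otimes>\<^bsub>C\<^esub> t a b \<otimes>\<^bsub>C\<^esub> chi K A S (S - X) \<otimes>\<^bsub>C\<^esub> t a' b' \<otimes>\<^bsub>C\<^esub> chi K A S X = t (a \<otimes>\<^bsub>A\<^esub> a') f"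
    using g h one A by (simp add: chi_eq f_def C_mult_tensor[OF one] C_mult_tensor[OF g(2,1)] C_mult_tensor[OF h(2,1)])
  ultimately show ?thesis using A by simp
qed

lemma chi_vanish:
  assumes X: "act_convex G S act X" and u: "u \<in> carrier T" and v: "v \<in> carrier T"
  shows "chi K A S X \<otimes>\<^bsub>C\<^esub> u \<otimes>\<^bsub>C\<^esub> chi K A S (S - X) \<otimes>\<^bsub>C\<^esub> v \<otimes>\<^bsub>C\<^esub> chi K A S X = \<zero>\<^bsub>T\<^esub>"
  using u
proof (induction rule: homogeneous_tensor_induct)
  case zero
  show ?case using v by (simp add: C_null chi_closed)
next
  case (add u g a b)
  note u = add.hyps(1) add.IH and gen = add.hyps(2-5)
  have "chi K A S X \<otimes>\<^bsub>C\<^esub> t a b \<otimes>\<^bsub>C\<^esub> chi K A S (S - X) \<otimes>\<^bsub>C\<^esub> v \<otimes>\<^bsub>C\<^esub> chi K A S X = \<zero>\<^bsub>T\<^esub>"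
    using v
  proof (induction rule: homogeneous_tensor_induct)
    case zero
    show ?case using gen by (simp add: C_null chi_closed C_mult_closed)
  next
    case (add v h a' b')
    then show ?case
      using gen chi_vanish_generators[OF X gen(1,2,4) add.hyps(2,3,5)]
      by (simp add: C_l_distr C_r_distr C_mult_closed chi_closed)
  qed
  then show ?case
    using u v gen by (simp add: C_l_distr C_r_distr C_mult_closed chi_closed)
qed

end

theorem proposition1p29:
  fixes K :: "'k ring"
    and G :: "'g monoid"
    and r :: "'g rel"
    and S :: "'s set"
    and act :: "'g \<Rightarrow> 's \<Rightarrow> 's"
    and A :: "('k, 'a) module"
    and Agr :: "'g \<Rightarrow> 'a set"
    and X :: "'s set"
  defines "C \<equiv> crossed_product K G A Agr S act"
  assumes "field K"
    and "ordered_monoid G r"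
    and "\<forall>g\<in>carrier G. (\<one>\<^bsub>G\<^esub>, g) \<in> r"
    and "effective_action G S act"
    and "graded_algebra K G A Agr"
    and "act_convex G S act X"
  shows "\<exists>h. h \<in> algebra_iso K
                  (quot_algebra C (ideal_of_elem C (chi K A S (S - X))))
                  (corner C (chi K A S X))"
proof -
  have "module K A"
    using \<open>graded_algebra K G A Agr\<close> by (simp add: graded_algebra_def assoc_algebra_def)
  then interpret graded_action K A S G Agr act
    using \<open>field K\<close> \<open>graded_algebra K G A Agr\<close> \<open>effective_action G S act\<close>
    by (intro graded_action.intro function_tensor.intro) (simp_all add: effective_action_def)
  interpret C: assoc_algebra K C
    unfolding C_def by (rule C_assoc_algebra)
  have "X \<subseteq> S" using \<open>act_convex G S act X\<close> by (simp add: act_convex_def)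
  show ?thesis
    by (rule exI, rule C.quot_iso_corner)
      (simp_all add: C_def C_simps(1-4) chi_closed chi_idempotent chi_complement[OF \<open>X \<subseteq> S\<close>]
        chi_vanish[OF \<open>act_convex G S act X\<close>])
qed

end
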